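(* Let $n\ge 1$, let $\theta:\mathbb{R}^n\to[0,\infty)$ be a radial, locally integrable function, and set $$I=\int_{\|y\|\ge 1}\frac{\theta(y)}{\|y\|^{n+1}}\,dy .$$ (a) If $f\in C_c(\mathbb{R}^n)$ satisfies, for some constant $C>0$, the estimate $|\hat f(y)|\le C e^{-\theta(y)}$ for all $y\in\mathbb{R}^n$, and $I=\infty$, then $f(x)=0$ for all $x\in\mathbb{R}^n$. (b) If the radial function $\theta$ is non-decreasing when regarded as a function on $[0,\infty)$ (i.e. as a function of $\|y\|$) and $I$ is finite, then there exist a non-zero radial function $f\in C_c^\infty(\mathbb{R}^n)$ and a constant $C>0$ such that $|\hat f(y)|\le C e^{-\theta(y)}$ for all $y\in\mathbb{R}^n$.
   Context: $C_c(\mathbb{R}^n)$ (resp. $C_c^\infty(\mathbb{R}^n)$) denotes the complex-valued compactly supported continuous (resp. smooth) functions on $\mathbb{R}^n$; $\|\cdot\|$ is the Euclidean norm. The Fourier transform of $f\in L^1(\mathbb{R}^n)$ is $\hat f(y)=\int_{\mathbb{R}^n}f(x)e^{-ix\cdot y}\,dx$. A function on $\mathbb{R}^n$ is radial if its value at $y$ depends only on $\|y\|$. *)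

theory Defs
  imports "HOL-Analysis.Analysis"
begin

definition radial :: "('a::real_normed_vector \<Rightarrow> 'b) \<Rightarrow> bool" where
  "radial f \<longleftrightarrow> (\<exists>g :: real \<Rightarrow> 'b. \<forall>y. f y = g (norm y))"

text \<open>A radial function whose profile on $[0,\infty)$ is non-decreasing; the profile is
  unconstrained at negative arguments.\<close>

definition radially_nondecreasing :: "('a::real_normed_vector \<Rightarrow> real) \<Rightarrow> bool" where
  "radially_nondecreasing f \<longleftrightarrow>
     (\<exists>g :: real \<Rightarrow> real. mono_on {0..} g \<and> (\<forall>y. f y = g (norm y)))"

text \<open>Local integrability with respect to the (complete) Lebesgue measure; Lebesgue measurability
  is part of the notion.\<close>

definition locally_integrable :: "('a::euclidean_space \<Rightarrow> real) \<Rightarrow> bool" where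
  "locally_integrable f \<longleftrightarrow> (\<forall>K. compact K \<longrightarrow> f absolutely_integrable_on K)"

definition compactly_supported :: "('a::real_normed_vector \<Rightarrow> complex) \<Rightarrow> bool" where
  "compactly_supported f \<longleftrightarrow> compact (closure (support_on UNIV f))"

definition Cc :: "('a::euclidean_space \<Rightarrow> complex) set" where
  "Cc = {f. continuous_on UNIV f \<and> compactly_supported f}"

text \<open>\<open>C_diff k f\<close>: \<open>f\<close> is $k$ times differentiable and all its iterated directional
  derivatives of order at most $k$ are continuous, i.e. \<open>f\<close> is of class $C^k$ over the reals.\<close>

primrec C_diff :: "nat \<Rightarrow> ('a::euclidean_space \<Rightarrow> complex) \<Rightarrow> bool" where
  "C_diff 0 f \<longleftrightarrow> continuous_on UNIV f"
| "C_diff (Suc k) f \<longleftrightarrow>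
     (\<forall>x. f differentiable (at x)) \<and> (\<forall>v. C_diff k (\<lambda>x. frechet_derivative f (at x) v))"

definition Cc_infinity :: "('a::euclidean_space \<Rightarrow> complex) set" where
  "Cc_infinity = {f. (\<forall>k. C_diff k f) \<and> compactly_supported f}"

definition fourier_transform :: "('a::euclidean_space \<Rightarrow> complex) \<Rightarrow> 'a \<Rightarrow> complex" where
  "fourier_transform f y =
     integral\<^sup>L lebesgue (\<lambda>x. f x * exp (- (\<i> * complex_of_real (x \<bullet> y))))"

text \<open>The integral is taken in $[0,\infty]$; the intended use is for non-negative \<open>\<theta>\<close>
  (\<open>ennreal\<close> truncates negative values to 0).\<close>

definition tail_integral :: "(real ^ 'n \<Rightarrow> real) \<Rightarrow> ennreal" where
  "tail_integral \<theta> =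
     (\<integral>\<^sup>+ y \<in> {y. norm y \<ge> 1}. ennreal (\<theta> y / norm y ^ (CARD('n) + 1)) \<partial>lebesgue)"

end

theory Submission
  imports Defs "HOL-Complex_Analysis.Complex_Analysis" "HOL-Probability.Probability"
    "HOL-Real_Asymp.Real_Asymp"
begin

text \<open>The dichotomy is the higher-dimensional form of a classical theorem of Ingham and Levinson on the
decay of Fourier transforms of compactly supported functions.

Divergent tail.  Along a line through the origin the Fourier transform of a function in \<open>Cc\<close> extends to an
entire function \<open>F\<close> of exponential type, bounded on the real axis.  For such a function the
logarithmic integral of \<open>ln (M / norm (F x)) / x\<^sup>2\<close> over \<open>x \<ge> 1\<close> is finite unless \<open>F\<close> vanishes
identically (\<open>log_integral_finite\<close>): after multiplication by an exponential and a Cayley transform this is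
Jensen's inequality for a bounded holomorphic function on the disc (\<open>log_mean_value_truncated\<close>).
The bound by \<open>C * exp (- \<theta> y)\<close> forces \<open>\<theta>\<close> below \<open>ln (M / norm F)\<close>, and the weight \<open>1 / norm y ^ (n + 1)\<close> is the one that
polar coordinates convert to \<open>1 / r\<^sup>2\<close> (\<open>radial_weighted_tail_finite\<close>).  So if \<open>I\<close> diverges, the transform vanishes
on every line through the origin, hence everywhere, and \<open>f = 0\<close> because the transform is injective on \<open>Cc\<close>
(\<open>fourier_transform_inject\<close>).

Convergent tail.  Let \<open>g\<close> be the non-decreasing profile of \<open>\<theta>\<close>.  The function sought is a smooth radial bump averaged over a random
translation \<open>Y\<close>, a series of independent uniform points of the unit ball in
which \<open>\<lceil>g (2 ^ (j + 1))\<rceil>\<close> summands carry the weight \<open>A / 2 ^ j\<close>.  The constant \<open>A\<close> is such that the characteristic function of one uniform point is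
at most \<open>exp (- 1)\<close> at frequencies of norm at least \<open>A\<close> (\<open>ball_char_decay\<close>).  The series is bounded because the sum of
\<open>g (2 ^ (j + 1)) / 2 ^ j\<close> converges, which follows from the convergence of \<open>I\<close>
(\<open>summable_of_tail_integral_finite\<close>); then the average is smooth with compact support
(\<open>smear_Cc_infinity\<close>).  Its transform is that of the bump times the infinite product of the
characteristic functions of the summands (\<open>dyadic_char_product\<close>), and at frequencies between \<open>2 ^ j\<close> and
\<open>2 ^ (j + 1)\<close> the \<open>j\<close>-th group of factors alone is at most \<open>exp (- g (2 ^ (j + 1)))\<close>.  Rotation
invariance of the factors gives a radial transform, and injectivity makes the function radial.\<close>

section \<open>Jensen's inequality on a circle\<close>

lemma integral_periodic_shift:
  fixes U :: "real \<Rightarrow> real"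
  assumes cont: "continuous_on UNIV U" and per: "\<And>t. U (t + p) = U t" and "0 \<le> p"
    and s: "a \<le> s" "s \<le> a + p"
  shows "integral {s..s + p} U = integral {a..a + p} U"
proof -
  have int: "U integrable_on {x..y}" for x y
    by (rule integrable_continuous_real) (use cont continuous_on_subset in blast)
  have "integral {s..a + p} U + integral {a + p..s + p} U = integral {s..s + p} U"
    by (rule Henstock_Kurzweil_Integration.integral_combine) (use s int in auto)
  moreover have "integral {a..s} U + integral {s..a + p} U = integral {a..a + p} U"
    by (rule Henstock_Kurzweil_Integration.integral_combine) (use s int in auto)
  moreover have "integral {a + p..s + p} U = integral {a..s} U"
    using integral_shift_real_ivl[of "a + p" p "s + p" U] per by simp
  ultimately show ?thesis by linarith
qed

text \<open>A left Riemann sum whose mesh is so fine that \<open>U\<close> cannot drop by more than \<open>e\<close> within one cell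
undershoots the integral cell by cell.\<close>

lemma sum_le_integral_of_small_oscillation:
  fixes U :: "real \<Rightarrow> real"
  assumes cont: "continuous_on UNIV U" and "0 \<le> d"
    and osc: "\<And>x y. x \<le> y \<Longrightarrow> y \<le> x + d \<Longrightarrow> U x \<le> U y + e"
  shows "(\<Sum>k<N. d * (U (s + real k * d) - e)) \<le> integral {s..s + real N * d} U"
proof (induction N)
  case (Suc N)
  have int: "U integrable_on {x..y}" for x y
    by (rule integrable_continuous_real) (use cont continuous_on_subset in blast)
  let ?t = "s + real N * d"
  have "integral {?t..?t + d} (\<lambda>_. U ?t - e) \<le> integral {?t..?t + d} U"
    by (rule integral_le) (use int in \<open>auto simp: diff_le_eq intro!: osc\<close>)
  moreover have "integral {?t..?t + d} (\<lambda>_. U ?t - e) = d * (U ?t - e)"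
    using \<open>0 \<le> d\<close> by simp
  moreover have "integral {s..?t} U + integral {?t..?t + d} U = integral {s..?t + d} U"
    by (rule Henstock_Kurzweil_Integration.integral_combine) (use \<open>0 \<le> d\<close> int in auto)
  moreover have "?t + d = s + real (Suc N) * d" by (simp add: algebra_simps)
  ultimately show ?case using Suc unfolding sum.lessThan_Suc by (metis add_mono)
qed simp

lemma max_modulus_circle:
  assumes hol: "H holomorphic_on ball 0 R" and r: "0 < r" "r < R"
  obtains s where "-pi \<le> s" "s \<le> pi" "norm (H 0) \<le> norm (H (of_real r * cis s))"
proof -
  have c: "continuous_on (cball 0 r) H"
    by (rule continuous_on_subset[OF holomorphic_on_imp_continuous_on[OF hol]]) (use r in auto)
  have "\<exists>z\<in>sphere 0 r. \<forall>w\<in>sphere 0 r. norm (H w) \<le> norm (H z)"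
    by (rule continuous_attains_sup)
      (use r in \<open>auto intro!: continuous_intros continuous_on_subset[OF c]\<close>)
  then obtain z where z: "norm z = r" and max: "\<And>w. norm w = r \<Longrightarrow> norm (H w) \<le> norm (H z)"
    by auto
  have "norm (H 0) \<le> norm (H z)"
    by (rule maximum_modulus_frontier[where S = "cball 0 r"])
      (use r z c max in \<open>auto intro: holomorphic_on_subset[OF hol]\<close>)
  moreover have "z = of_real r * cis (Arg z)"
    by (metis Arg_eq z complex_norm_eq_1_exp mult.commute rcis_cmod_Arg rcis_def)
  ultimately show thesis
    by (metis that[of "Arg z"] Arg_bounded less_eq_real_def)
qed

text \<open>The inequality half of Jensen's formula, with the logarithm truncated from below so that zeros of
\<open>h\<close> need no separate treatment.  The product of \<open>h\<close> over \<open>N\<close> equally spaced rotations is again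
holomorphic, with value \<open>h 0 ^ N\<close> at the centre, so the maximum modulus principle supplies one
rotation angle \<open>s\<close> at which the modulus of the product on the circle is at least
\<open>norm (h 0) ^ N\<close>.  Taking logarithms, the equally spaced Riemann sum of
\<open>ln (max (norm h) \<delta>)\<close> that starts at \<open>s\<close> is at least \<open>N * ln (norm (h 0))\<close>; by uniform
continuity and periodicity that sum is close to the integral, whatever \<open>s\<close> is.\<close>

lemma log_mean_value_truncated:
  assumes hol: "h holomorphic_on ball 0 R" and r: "0 < r" "r < R"
    and h0: "h 0 \<noteq> 0" and "0 < \<delta>"
  shows "2 * pi * ln (norm (h 0)) \<le> integral {-pi..pi} (\<lambda>t. ln (max (norm (h (of_real r * cis t))) \<delta>))"
proof (rule field_le_epsilon)
  define U where "U t = ln (max (norm (h (of_real r * cis t))) \<delta>)" for t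
  fix e' :: real assume "0 < e'"
  define e where "e = e' / (2 * pi)"
  have "0 < e" using \<open>0 < e'\<close> by (simp add: e_def)
  have hc: "continuous_on (ball 0 R) h" by (rule holomorphic_on_imp_continuous_on[OF hol])
  have "continuous_on UNIV (\<lambda>t. h (of_real r * cis t))"
    by (rule continuous_on_compose2[OF hc]) (use r in \<open>auto intro!: continuous_intros simp: norm_mult\<close>)
  then have cont: "continuous_on UNIV U"
    unfolding U_def using \<open>0 < \<delta>\<close> by (intro continuous_intros) (auto simp: max_def)
  have per: "U (t + 2 * pi) = U t" for t
    by (simp add: U_def cis.ctr)
  have per_n: "U (t + 2 * pi * real n) = U t" for t n
  proof (induction n)
    case (Suc n)
    then show ?case using per[of "t + 2 * pi * real n"] by (simp add: algebra_simps)
  qed simp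
  have "uniformly_continuous_on {-pi..4 * pi} U"
    by (rule compact_uniformly_continuous) (use cont continuous_on_subset in blast, simp)
  then obtain d0 where d0: "d0 > 0"
    and uc: "\<And>x y. x \<in> {-pi..4*pi} \<Longrightarrow> y \<in> {-pi..4*pi} \<Longrightarrow> \<bar>y - x\<bar> < d0 \<Longrightarrow> \<bar>U y - U x\<bar> < e"
    unfolding uniformly_continuous_on_def dist_real_def using \<open>0 < e\<close> by metis
  obtain N :: nat where N: "N > 0" "2 * pi / d0 < real N" "real N \<ge> 2"
  proof -
    obtain N0 :: nat where "max (2 * pi / d0) 2 < real N0" using reals_Archimedean2 by blast
    then show thesis by (intro that[of N0]) auto
  qed
  define d where "d = 2 * pi / real N"
  have d: "0 < d" "d < d0" "d \<le> pi"
    using N d0 by (auto simp: d_def field_simps)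
  have Nd: "real N * d = 2 * pi" using N by (simp add: d_def)
  have osc: "U x \<le> U y + e" if "x \<le> y" "y \<le> x + d" for x y
  proof -
    \<comment> \<open>translate both points by a multiple of the period into the compact window\<close>
    define m where "m = \<lfloor>x / (2 * pi)\<rfloor>"
    have m: "of_int m * (2 * pi) \<le> x" "x < (of_int m + 1) * (2 * pi)"
      using floor_divide_lower[of "2*pi" x] floor_divide_upper[of "2*pi" x] by (auto simp: m_def)
    have sh: "U (t - of_int m * (2 * pi)) = U t" for t
    proof (cases "m \<ge> 0")
      case True
      then show ?thesis using per_n[of "t - of_int m * (2 * pi)" "nat m"] by (simp add: algebra_simps)
    next
      case False
      then show ?thesis using per_n[of t "nat (-m)"] by (simp add: algebra_simps)
    qed
    have "\<bar>U (y - of_int m * (2 * pi)) - U (x - of_int m * (2 * pi))\<bar> < e"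
      by (rule uc) (use m that d pi_gt_zero in \<open>auto simp: algebra_simps\<close>)
    then show ?thesis unfolding sh by linarith
  qed
  define H where "H z = (\<Prod>k<N. h (cis (real k * d) * z))" for z
  have "H holomorphic_on ball 0 R"
    unfolding H_def
    by (intro holomorphic_on_prod holomorphic_on_compose_gen[OF _ hol, unfolded o_def] holomorphic_intros)
      (auto simp: norm_mult)
  then obtain s where s: "-pi \<le> s" "s \<le> pi" and mx: "norm (H 0) \<le> norm (H (of_real r * cis s))"
    by (rule max_modulus_circle[OF _ r])
  have H0: "norm (H 0) = norm (h 0) ^ N" by (simp add: H_def norm_power)
  have "real N * ln (norm (h 0)) = ln (norm (H 0))"
    using h0 by (simp add: H0 ln_realpow)
  also have "\<dots> \<le> ln (\<Prod>k<N. max (norm (h (of_real r * cis (s + real k * d)))) \<delta>)"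
  proof (rule ln_mono)
    show "0 < norm (H 0)" using h0 by (simp add: H0)
    have "norm (H (of_real r * cis s)) = (\<Prod>k<N. norm (h (of_real r * cis (s + real k * d))))"
      by (simp add: H_def prod_norm cis_mult[symmetric] mult_ac)
    also have "\<dots> \<le> (\<Prod>k<N. max (norm (h (of_real r * cis (s + real k * d)))) \<delta>)"
      by (rule prod_mono) auto
    finally show "norm (H 0) \<le> \<dots>" using mx by linarith
  qed
  also have "\<dots> = (\<Sum>k<N. U (s + real k * d))"
    unfolding U_def by (rule ln_prod) (use \<open>0 < \<delta>\<close> in \<open>auto simp: max_def\<close>)
  finally have "d * (real N * ln (norm (h 0))) \<le> d * (\<Sum>k<N. U (s + real k * d))"
    using d by (intro mult_left_mono) auto
  also have "\<dots> = (\<Sum>k<N. d * (U (s + real k * d) - e)) + real N * d * e"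
    by (simp add: sum_distrib_left algebra_simps sum_subtractf)
  also have "\<dots> \<le> integral {s..s + real N * d} U + real N * d * e"
    using sum_le_integral_of_small_oscillation[OF cont less_imp_le[OF d(1)] osc] by simp
  also have "integral {s..s + real N * d} U = integral {-pi..-pi + 2 * pi} U"
    unfolding Nd using s by (intro integral_periodic_shift cont per) auto
  also have "real N * d * e = e'" unfolding Nd by (simp add: e_def)
  finally show "2 * pi * ln (norm (h 0)) \<le> integral {-pi..pi} U + e'"
    by (simp add: mult.assoc[symmetric] mult.commute[of d] Nd)
qed

section \<open>The logarithmic integral of an entire function of exponential type\<close>

text \<open>The Cayley map of the unit disc onto the upper half-plane that sends the centre to \<open>\<i> * b\<close>; the
half-angle substitution turns the unit circle into the real line.\<close>

definition cayley_real :: "real \<Rightarrow> complex \<Rightarrow> complex" where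
  "cayley_real b w = \<i> * of_real b * (1 - w) / (1 + w)"

lemma cayley_real_0 [simp]: "cayley_real b 0 = \<i> * of_real b"
  by (simp add: cayley_real_def)

lemma cayley_real_cis: "0 < b \<Longrightarrow> cayley_real b (cis (2 * arctan (x / b))) = of_real x"
proof -
  assume b: "0 < b"
  define u where "u = x / b"
  have u: "1 + u\<^sup>2 > 0" by (simp add: add_pos_nonneg)
  have nz: "1 - \<i> * of_real u \<noteq> 0" by (simp add: complex_eq_iff)
  have "cis (2 * arctan u) = cis (arctan u) * cis (arctan u)"
    by (simp add: cis_mult)
  also have "cis (arctan u) = (1 + \<i> * of_real u) / of_real (sqrt (1 + u\<^sup>2))"
    by (simp add: complex_eq_iff cos_arctan sin_arctan)
  also have "\<dots> * \<dots> = (1 + \<i> * of_real u)\<^sup>2 / of_real (1 + u\<^sup>2)"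
    using u by (simp add: power2_eq_square del: of_real_add flip: of_real_mult)
  also have "of_real (1 + u\<^sup>2) = (1 + \<i> * of_real u) * (1 - \<i> * of_real u)"
    by (simp add: complex_eq_iff power2_eq_square)
  finally have c: "cis (2 * arctan u) = (1 + \<i> * of_real u) / (1 - \<i> * of_real u)"
    using nz by (auto simp: power2_eq_square complex_eq_iff)
  have "1 - cis (2 * arctan u) = - 2 * \<i> * of_real u / (1 - \<i> * of_real u)"
    "1 + cis (2 * arctan u) = 2 / (1 - \<i> * of_real u)"
    unfolding c using nz by (simp_all add: field_simps)
  then have "cayley_real b (cis (2 * arctan u)) = \<i> * of_real b * (- \<i> * of_real u)"
    using nz by (simp add: cayley_real_def)
  then show ?thesis using b by (simp add: u_def)
qed

lemma cis_2arctan_ne: "1 + cis (2 * arctan u) \<noteq> 0"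
proof
  assume "1 + cis (2 * arctan u) = 0"
  then have "1 + cos (2 * arctan u) = 0" by (simp add: complex_eq_iff)
  then have "cos (arctan u) = 0" by (simp add: cos_double_cos)
  then show False by (simp add: cos_arctan_not_zero)
qed

lemma Im_cayley_real_nonneg:
  assumes "0 < b" "norm w < 1"
  shows "0 \<le> Im (cayley_real b w)"
proof -
  have "Im (cayley_real b w) = b * Re ((1 - w) / (1 + w))"
    by (simp add: cayley_real_def mult.assoc flip: times_divide_eq_right)
  moreover have "(Re w)\<^sup>2 + (Im w)\<^sup>2 \<le> 1"
    using assms power_le_one[of "norm w" 2] by (simp add: cmod_power2)
  then have "0 \<le> Re ((1 - w) / (1 + w))"
    unfolding Re_divide by (intro divide_nonneg_nonneg sum_power2_ge_zero) (simp add: algebra_simps power2_eq_square)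
  ultimately show ?thesis using assms by simp
qed

lemma holomorphic_cayley_real: "cayley_real b holomorphic_on ball 0 1"
proof -
  have "1 + w \<noteq> 0" if "norm w < 1" for w :: complex
    using that by (metis add_eq_0_iff norm_minus_cancel norm_one order_less_irrefl)
  then show ?thesis unfolding cayley_real_def[abs_def] by (intro holomorphic_intros) auto
qed

text \<open>Jensen's inequality is centred at a point where the function does not vanish.  Zeros are isolated, so such a
point exists on the positive imaginary axis.\<close>

lemma entire_nonzero_imag_axis:
  assumes hol: "F holomorphic_on UNIV" and "F w \<noteq> 0"
  obtains b :: real where "0 < b" "F (\<i> * of_real b) \<noteq> 0"
proof (rule ccontr)
  assume "\<not> thesis"
  with that have z: "F z = 0" if "z \<in> (\<lambda>b. \<i> * of_real b) ` {0<..}" for z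
    using that by auto
  have "0 islimpt (\<lambda>b. \<i> * complex_of_real b) ` {0<..}"
    unfolding islimpt_approachable
  proof (intro allI impI)
    fix e :: real assume "0 < e"
    then show "\<exists>x'\<in>(\<lambda>b. \<i> * complex_of_real b) ` {0<..}. x' \<noteq> 0 \<and> dist x' 0 < e"
      by (intro bexI[of _ "\<i> * complex_of_real (e / 2)"] conjI imageI) (auto simp: norm_mult)
  qed
  then have "F w = 0"
    by (rule analytic_continuation[OF hol open_UNIV connected_UNIV subset_UNIV UNIV_I _ z UNIV_I])
  then show False using assms by simp
qed

text \<open>When the truncation level \<open>M * exp (- n)\<close> sinks to zero, the truncated logarithms recover the full
one, including the value infinity at a zero.  This is the pointwise convergence behind Fatou's lemma
in the next theorem.\<close>

lemma ennreal_log_liminf: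
  assumes lim: "y \<longlonglongrightarrow> y0" and ynn: "\<And>n. 0 \<le> y n" and M: "0 < M"
  shows "(\<lambda>n. ennreal (ln M - ln (max (y n) (M * exp (- real n)))))
     \<longlonglongrightarrow> (if y0 = 0 then \<infinity> else ennreal (ln (M / y0)))"
proof -
  have y0: "0 \<le> y0" using lim ynn by (meson LIMSEQ_le_const)
  have "(\<lambda>n. M * exp (- real n)) \<longlonglongrightarrow> 0" by real_asymp
  then have mx: "(\<lambda>n. max (y n) (M * exp (- real n))) \<longlonglongrightarrow> y0"
    using tendsto_max[OF lim, of "\<lambda>n. M * exp (- real n)" 0] y0 by (simp add: max_absorb1)
  show ?thesis
  proof (cases "y0 = 0")
    case True
    have "filterlim (\<lambda>n. max (y n) (M * exp (- real n))) (at_right 0) sequentially"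
      unfolding filterlim_at
    proof (intro conjI always_eventually allI)
      fix n
      have "0 < max (y n) (M * exp (- real n))"
        using less_le_trans[OF mult_pos_pos[OF M exp_gt_zero] max.cobounded2] .
      then show "max (y n) (M * exp (- real n)) \<in> {0<..}" "max (y n) (M * exp (- real n)) \<noteq> 0"
        by auto
    qed (use mx True in simp)
    then have "filterlim (\<lambda>n. ln (max (y n) (M * exp (- real n)))) at_bot sequentially"
      by (rule filterlim_compose[OF ln_at_0])
    then have "filterlim (\<lambda>n. - ln (max (y n) (M * exp (- real n)))) at_top sequentially"
      by (simp add: filterlim_uminus_at_top)
    from filterlim_tendsto_add_at_top[OF tendsto_const[of "ln M"] this]
    have "filterlim (\<lambda>n. ln M - ln (max (y n) (M * exp (- real n)))) at_top sequentially"
      by simp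
    then show ?thesis using True by (simp add: ennreal_tendsto_top_eq_at_top)
  next
    case False
    then have "(\<lambda>n. ln M - ln (max (y n) (M * exp (- real n)))) \<longlonglongrightarrow> ln M - ln y0"
      by (intro tendsto_intros mx)
    moreover have "ln M - ln y0 = ln (M / y0)" using False M y0 by (simp add: ln_div)
    ultimately show ?thesis using False by (auto intro: tendsto_ennrealI)
  qed
qed

text \<open>The classical finiteness of the logarithmic integral.  Multiplying \<open>F\<close> by \<open>exp (\<i> * B * z)\<close> does not
change the modulus on the real line and cancels the exponential growth in the upper half-plane, so
the product \<open>G\<close> is bounded there by \<open>M\<close>.  Transported to the unit disc, Jensen's inequality bounds the mean of
\<open>ln (M / norm G)\<close> over every circle of radius less than one by its value at the centre.
The integrands are nonnegative, so the bound survives the limit to the unit circle by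
Fatou's lemma.  The substitution \<open>t = 2 * arctan (x / b)\<close> turns arc length into the Poisson kernel
\<open>2 * b / (b\<^sup>2 + x\<^sup>2)\<close>, which dominates a multiple of \<open>1 / x\<^sup>2\<close> for \<open>x \<ge> 1\<close>.\<close>

theorem log_integral_finite:
  fixes F :: "complex \<Rightarrow> complex"
  assumes hol: "F holomorphic_on UNIV"
    and bd: "\<And>z. norm (F z) \<le> A * exp (B * \<bar>Im z\<bar>)"
    and nz: "F z0 \<noteq> 0" and M: "0 < M" "A \<le> M"
  shows "(\<integral>\<^sup>+x\<in>{1..}. (if F (of_real x) = 0 then \<infinity> else ennreal (ln (M / norm (F (of_real x)))))
            * ennreal (1 / x\<^sup>2) \<partial>lborel) < \<infinity>"
proof -
  obtain b where b: "0 < b" and Fb: "F (\<i> * of_real b) \<noteq> 0"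
    using entire_nonzero_imag_axis[OF hol nz] by blast
  define G where "G z = F z * exp (\<i> * of_real B * z)" for z
  have holG: "G holomorphic_on UNIV"
    unfolding G_def by (intro holomorphic_intros hol)
  have normG: "norm (G z) = norm (F z) * exp (- B * Im z)" for z
    by (simp add: G_def norm_mult)
  have G_le: "norm (G z) \<le> M" if "0 \<le> Im z" for z
  proof -
    have "norm (G z) \<le> A * exp (B * \<bar>Im z\<bar>) * exp (- B * Im z)"
      unfolding normG by (intro mult_right_mono bd) auto
    also have "\<dots> = A" using that by (simp add: mult.assoc flip: exp_add)
    finally show ?thesis using M by linarith
  qed
  define h where "h = G \<circ> cayley_real b"
  have holh: "h holomorphic_on ball 0 1"
    unfolding h_def by (rule holomorphic_on_compose_gen[OF holomorphic_cayley_real holG]) auto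
  have h_le: "norm (h w) \<le> M" if "norm w < 1" for w
    unfolding h_def o_def by (intro G_le Im_cayley_real_nonneg b that)
  have h0: "h 0 \<noteq> 0" using Fb by (simp add: h_def G_def)
  \<comment> \<open>one index drives both limits: the radius tends to 1 and the truncation level to 0\<close>
  define \<rho> :: "nat \<Rightarrow> real" where "\<rho> n = 1 - 1 / (real n + 2)" for n
  have \<rho>: "0 < \<rho> n" "\<rho> n < 1" for n by (auto simp: \<rho>_def field_simps)
  have \<rho>_lim: "\<rho> \<longlonglongrightarrow> 1" unfolding \<rho>_def by real_asymp
  define v where "v n t = ln M - ln (max (norm (h (of_real (\<rho> n) * cis t))) (M * exp (- real n)))" for n t
  have v_nn: "0 \<le> v n t" for n t
  proof -
    have "norm (h (of_real (\<rho> n) * cis t)) \<le> M" using \<rho>[of n] by (intro h_le) (simp add: norm_mult)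
    moreover have "M * exp (- real n) \<le> M * 1" using M by (intro mult_left_mono) auto
    ultimately have "max (norm (h (of_real (\<rho> n) * cis t))) (M * exp (- real n)) \<le> M" by simp
    then show ?thesis unfolding v_def using M by (simp add: less_max_iff_disj)
  qed
  have v_cont: "continuous_on UNIV (v n)" for n
  proof -
    have "continuous_on UNIV (\<lambda>t. h (of_real (\<rho> n) * cis t))"
      by (rule continuous_on_compose2[OF holomorphic_on_imp_continuous_on[OF holh]])
        (use \<rho>[of n] in \<open>auto intro!: continuous_intros simp: norm_mult\<close>)
    then show ?thesis
      unfolding v_def using M by (intro continuous_intros) (auto simp: max_def)
  qed
  define D where "D = 2 * pi * (ln M - ln (norm (h 0)))"
  have v_int: "(\<integral>\<^sup>+t. ennreal (v n t) * indicator {-pi..pi} t \<partial>lborel) \<le> ennreal D" for n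
  proof -
    have int: "v n integrable_on {-pi..pi}"
      by (rule integrable_continuous_real) (use v_cont continuous_on_subset in blast)
    let ?u = "\<lambda>t. ln (max (norm (h (of_real (\<rho> n) * cis t))) (M * exp (- real n)))"
    have "(\<lambda>t. ln M - v n t) integrable_on {-pi..pi}" by (intro integrable_diff int) auto
    then have u: "?u integrable_on {-pi..pi}" by (simp add: v_def)
    have "integral {-pi..pi} (v n) = 2 * pi * ln M - integral {-pi..pi} ?u"
      unfolding v_def using u by (subst Henstock_Kurzweil_Integration.integral_diff) auto
    also have "\<dots> \<le> D"
      using log_mean_value_truncated[OF holh \<rho>[of n] h0, of "M * exp (- real n)"] M
      by (simp add: D_def algebra_simps)
    finally have "integral {-pi..pi} (v n) \<le> D" .
    moreover have "(\<integral>\<^sup>+t. ennreal (v n t) * indicator {-pi..pi} t \<partial>lborel) = ennreal (integral {-pi..pi} (v n))"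
      by (rule nn_integral_has_integral_lebesgue') (use v_nn int in auto)
    ultimately show ?thesis by (simp add: ennreal_leI)
  qed
  define g where "g x = 2 * arctan (x / b)" for x
  define g' where "g' x = 2 * b / (b\<^sup>2 + x\<^sup>2)" for x
  have pos: "0 < b\<^sup>2 + x\<^sup>2" for x using b by (simp add: add_pos_nonneg)
  have g'nn: "0 \<le> g' x" for x using b by (simp add: g'_def)
  have dg: "(g has_real_derivative g' x) (at x)" for x
  proof -
    have "(g has_real_derivative 2 * (inverse (1 + (x / b)\<^sup>2) * (1 / b))) (at x)"
      unfolding g_def using b by (auto intro!: derivative_eq_intros)
    moreover have "2 * (inverse (1 + (x / b)\<^sup>2) * (1 / b)) = g' x"
      using b pos[of x] unfolding g'_def by (simp add: field_simps power2_eq_square)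
    ultimately show ?thesis by simp
  qed
  have g'_cont: "continuous_on UNIV g'"
    unfolding g'_def by (intro continuous_intros) (use pos in \<open>metis less_irrefl\<close>)
  have g_cont: "continuous_on UNIV g"
    using dg by (meson DERIV_continuous continuous_at_imp_continuous_on)
  have g_range: "g x \<in> {-pi..pi}" for x
    using arctan_bounded[of "x / b"] by (auto simp: g_def)
  define w where "w n x = ennreal (v n (g x)) * ennreal (g' x) * indicator {1..real n + 2} x" for n x
  have w_int: "(\<integral>\<^sup>+x. w n x \<partial>lborel) \<le> ennreal D" for n
  proof -
    have "(\<integral>\<^sup>+x. w n x \<partial>lborel) = (\<integral>\<^sup>+x. ennreal (v n (g x) * g' x) * indicator {1..real n + 2} x \<partial>lborel)"
      unfolding w_def using v_nn g'nn by (simp add: ennreal_mult)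
    also have "\<dots> = (\<integral>\<^sup>+x. ennreal (v n (g x) * g' x * indicator {1..real n + 2} x) \<partial>lborel)"
      by (intro nn_integral_cong) (auto simp: indicator_def)
    also have "\<dots> = (\<integral>\<^sup>+t. ennreal (v n t * indicator {g 1..g (real n + 2)} t) \<partial>lborel)"
    proof (rule nn_integral_substitution[symmetric])
      show "set_borel_measurable borel {g 1..g (real n + 2)} (v n)"
        unfolding set_borel_measurable_def
        by (intro borel_measurable_scaleR borel_measurable_indicator borel_measurable_continuous_onI v_cont) auto
      show "continuous_on {1..real n + 2} g'" using g'_cont continuous_on_subset by blast
    qed (use dg g'nn in auto)
    also have "\<dots> \<le> (\<integral>\<^sup>+t. ennreal (v n t) * indicator {-pi..pi} t \<partial>lborel)"
      using g_range[of 1] g_range[of "real n + 2"] by (intro nn_integral_mono) (auto simp: indicator_def)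
    also have "\<dots> \<le> ennreal D" by (rule v_int)
    finally show ?thesis .
  qed
  define L where "L x = (if F (of_real x) = 0 then \<infinity> else ennreal (ln (M / norm (F (of_real x)))))" for x :: real
  have w_lim: "(\<lambda>n. w n x) \<longlonglongrightarrow> L x * ennreal (g' x)" if x: "1 \<le> x" for x
  proof -
    have "isCont (cayley_real b) (cis (g x))"
      unfolding cayley_real_def g_def using cis_2arctan_ne[of "x / b"] by (intro continuous_intros) auto
    moreover have "isCont G z" for z
      using holomorphic_on_imp_continuous_on[OF holG] by (simp add: continuous_on_eq_continuous_at)
    ultimately have "isCont (\<lambda>w. norm (h w)) (cis (g x))"
      unfolding h_def o_def by (intro continuous_norm isCont_o2[of _ "cayley_real b" G])
    moreover have "(\<lambda>n. of_real (\<rho> n) * cis (g x)) \<longlonglongrightarrow> of_real 1 * cis (g x)"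
      by (intro tendsto_intros \<rho>_lim)
    ultimately have lim: "(\<lambda>n. norm (h (of_real (\<rho> n) * cis (g x)))) \<longlonglongrightarrow> norm (h (cis (g x)))"
      by (intro isCont_tendsto_compose[of _ "\<lambda>w. norm (h w)"]) auto
    have "h (cis (g x)) = G (of_real x)"
      using cayley_real_cis[OF b] by (simp add: h_def g_def)
    then have eq: "norm (h (cis (g x))) = norm (F (of_real x))" by (simp add: normG)
    have "(\<lambda>n. ennreal (v n (g x))) \<longlonglongrightarrow> L x"
      using ennreal_log_liminf[OF lim[unfolded eq] _ M(1)] by (simp add: v_def L_def)
    moreover have "0 < g' x" using b pos[of x] by (simp add: g'_def)
    ultimately have "(\<lambda>n. ennreal (v n (g x)) * ennreal (g' x)) \<longlonglongrightarrow> L x * ennreal (g' x)"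
      by (intro tendsto_mult_ennreal) auto
    moreover have "\<forall>\<^sub>F n in sequentially. w n x = ennreal (v n (g x)) * ennreal (g' x)"
      using eventually_ge_at_top[of "nat \<lceil>x\<rceil>"]
      by eventually_elim (use x in \<open>auto simp: w_def\<close>)
    ultimately show ?thesis by (simp add: tendsto_cong)
  qed
  define c where "c = (b\<^sup>2 + 1) / (2 * b)"
  have "0 < c" using b by (auto simp: c_def intro!: divide_pos_pos add_nonneg_pos)
  have Lc: "L x * ennreal (1 / x\<^sup>2) \<le> ennreal c * (L x * ennreal (g' x))" if x: "1 \<le> x" for x
  proof -
    have "b\<^sup>2 + x\<^sup>2 \<le> (b\<^sup>2 + 1) * x\<^sup>2"
      using x mult_left_mono[of 1 "x\<^sup>2" "b\<^sup>2"] by (simp add: algebra_simps)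
    then have "(b\<^sup>2 + 1) / ((b\<^sup>2 + 1) * x\<^sup>2) \<le> (b\<^sup>2 + 1) / (b\<^sup>2 + x\<^sup>2)"
      using pos[of x] by (intro divide_left_mono) (auto intro!: mult_pos_pos simp: add_nonneg_pos)
    moreover have "b\<^sup>2 + 1 \<noteq> 0" using pos[of 1] by simp
    ultimately have "1 / x\<^sup>2 \<le> c * g' x"
      using b by (simp add: c_def g'_def)
    then have "ennreal (1 / x\<^sup>2) \<le> ennreal c * ennreal (g' x)"
      using \<open>0 < c\<close> g'nn by (simp add: ennreal_leI flip: ennreal_mult)
    then have "L x * ennreal (1 / x\<^sup>2) \<le> L x * (ennreal c * ennreal (g' x))"
      by (rule mult_left_mono) simp
    then show ?thesis by (simp add: mult_ac)
  qed
  have meas [measurable]: "w n \<in> borel_measurable lborel" for n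
  proof -
    have "v n \<in> borel_measurable borel" "g \<in> borel_measurable borel" "g' \<in> borel_measurable borel"
      by (intro borel_measurable_continuous_onI v_cont g_cont g'_cont)+
    then show ?thesis unfolding w_def by measurable
  qed
  have "(\<integral>\<^sup>+x\<in>{1..}. L x * ennreal (1 / x\<^sup>2) \<partial>lborel) \<le> (\<integral>\<^sup>+x. ennreal c * liminf (\<lambda>n. w n x) \<partial>lborel)"
  proof (intro nn_integral_mono)
    fix x :: real
    show "L x * ennreal (1 / x\<^sup>2) * indicator {1..} x \<le> ennreal c * liminf (\<lambda>n. w n x)"
    proof (cases "1 \<le> x")
      case True
      then have "liminf (\<lambda>n. w n x) = L x * ennreal (g' x)"
        by (intro lim_imp_Liminf w_lim) auto
      then show ?thesis using Lc[OF True] True by simp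
    qed simp
  qed
  also have "\<dots> = ennreal c * (\<integral>\<^sup>+x. liminf (\<lambda>n. w n x) \<partial>lborel)"
    by (rule nn_integral_cmult) measurable
  also have "\<dots> \<le> ennreal c * liminf (\<lambda>n. \<integral>\<^sup>+x. w n x \<partial>lborel)"
    by (intro mult_left_mono nn_integral_liminf meas) auto
  also have "\<dots> \<le> ennreal c * liminf (\<lambda>n. ennreal D)"
    by (intro mult_left_mono Liminf_mono) (auto simp: w_int)
  also have "\<dots> < \<infinity>" by (simp add: Liminf_const ennreal_mult_less_top)
  finally show ?thesis unfolding L_def .
qed

section \<open>Polar coordinates for radial integrands\<close>

text \<open>Polar coordinates for radial integrands: both sides give the interval up to \<open>r\<close> the volume of the ball of
radius \<open>r\<close>, and these intervals generate the Borel sets.\<close>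

lemma distr_norm_lborel:
  "distr (lborel :: 'a::euclidean_space measure) borel norm =
     density lborel (\<lambda>r. ennreal (unit_ball_vol (real DIM('a)) * real DIM('a) * r ^ (DIM('a) - 1)) * indicator {0..} r)"
    (is "?P = ?Q")
proof -
  define c where "c = unit_ball_vol (real DIM('a))"
  define n where "n = DIM('a)"
  have n: "0 < n" by (simp add: n_def)
  have c: "0 < c" unfolding c_def by (rule unit_ball_vol_pos) simp
  have Q: "?Q = density lborel (\<lambda>r. ennreal (c * real n * r ^ (n - 1)) * indicator {0..} r)"
    by (simp add: c_def n_def)
  have mP: "emeasure ?P {..r} = (if 0 \<le> r then ennreal (c * r ^ n) else 0)" for r
  proof -
    have "emeasure ?P {..r} = emeasure lborel (cball (0::'a) r)"
      by (subst emeasure_distr) (auto simp: cball_def vimage_def)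
    then show ?thesis by (auto simp: emeasure_cball c_def n_def)
  qed
  have mQ: "emeasure ?Q {..r} = (if 0 \<le> r then ennreal (c * r ^ n) else 0)" for r
  proof -
    have "emeasure ?Q {..r} = (\<integral>\<^sup>+x. ennreal (c * real n * x ^ (n - 1)) * indicator {0..r} x \<partial>lborel)"
      unfolding Q by (subst emeasure_density) (auto intro!: nn_integral_cong simp: indicator_def)
    also have "\<dots> = (if 0 \<le> r then ennreal (c * r ^ n) else 0)"
    proof (cases "0 \<le> r")
      case True
      have "(\<integral>\<^sup>+x. ennreal (c * real n * x ^ (n - 1)) * indicator {0..r} x \<partial>lborel) = ennreal (c * r ^ n - c * 0 ^ n)"
        by (rule nn_integral_FTC_Icc)
          (use True c n in \<open>auto intro!: derivative_eq_intros simp: mult_ac\<close>)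
      then show ?thesis using True n by (simp add: power_0_left)
    qed simp
    finally show ?thesis .
  qed
  show ?thesis
  proof (rule measure_eqI_generator_eq[where E = "range atMost" and \<Omega> = UNIV and A = "\<lambda>i. {..real i}"])
    show "Int_stable (range (atMost :: real \<Rightarrow> _))"
      by (auto simp: Int_stable_def)
    show "emeasure ?P X = emeasure ?Q X" if "X \<in> range atMost" for X
    proof -
      from that obtain r where "X = {..r}" by blast
      then show ?thesis by (simp only: mP mQ)
    qed
    show "(\<Union>i. {..real i}) = UNIV" using real_arch_simple by auto
    show "sets ?P = sigma_sets UNIV (range atMost)" "sets ?Q = sigma_sets UNIV (range atMost)"
      using borel_eq_atMost[where 'a = real] by (simp_all add: borel_eq_atMost)
    show "emeasure ?P {..real i} \<noteq> \<infinity>" for i by (simp add: mP)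
  qed auto
qed

theorem nn_integral_radial:
  fixes f :: "real \<Rightarrow> ennreal"
  assumes [measurable]: "f \<in> borel_measurable borel"
  shows "(\<integral>\<^sup>+x. f (norm (x::'a::euclidean_space)) \<partial>lborel) =
    ennreal (unit_ball_vol (real DIM('a)) * real DIM('a)) *
      (\<integral>\<^sup>+r\<in>{0..}. f r * ennreal (r ^ (DIM('a) - 1)) \<partial>lborel)"
proof -
  have nn: "0 \<le> unit_ball_vol (real DIM('a)) * real DIM('a)" by (simp add: unit_ball_vol_nonneg)
  have "(\<integral>\<^sup>+x. f (norm (x::'a)) \<partial>lborel) = (\<integral>\<^sup>+r. f r \<partial>distr (lborel :: 'a measure) borel norm)"
    by (subst nn_integral_distr) auto
  also have "\<dots> = (\<integral>\<^sup>+r. ennreal (unit_ball_vol (real DIM('a)) * real DIM('a)) *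
      (f r * ennreal (r ^ (DIM('a) - 1)) * indicator {0..} r) \<partial>lborel)"
    unfolding distr_norm_lborel
    by (subst nn_integral_density)
      (auto intro!: nn_integral_cong simp: indicator_def nn ennreal_mult' ennreal_mult mult_ac)
  also have "\<dots> = ennreal (unit_ball_vol (real DIM('a)) * real DIM('a)) *
      (\<integral>\<^sup>+r\<in>{0..}. f r * ennreal (r ^ (DIM('a) - 1)) \<partial>lborel)"
    by (subst nn_integral_cmult) auto
  finally show ?thesis .
qed

lemma radial_weighted_tail_finite:
  fixes L :: "real \<Rightarrow> ennreal"
  assumes [measurable]: "L \<in> borel_measurable borel"
    and fin: "(\<integral>\<^sup>+r\<in>{1..}. L r * ennreal (1 / r\<^sup>2) \<partial>lborel) < \<infinity>"
  shows "(\<integral>\<^sup>+y\<in>{y::'a::euclidean_space. 1 \<le> norm y}. L (norm y) * ennreal (1 / norm y ^ (DIM('a) + 1)) \<partial>lborel) < \<infinity>"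
proof -
  let ?f = "\<lambda>r. L r * ennreal (1 / r ^ (DIM('a) + 1)) * indicator {1..} r"
  have "(\<integral>\<^sup>+y\<in>{y::'a. 1 \<le> norm y}. L (norm y) * ennreal (1 / norm y ^ (DIM('a) + 1)) \<partial>lborel)
      = (\<integral>\<^sup>+y. ?f (norm (y::'a)) \<partial>lborel)"
    by (intro nn_integral_cong) (auto simp: indicator_def)
  also have "\<dots> = ennreal (unit_ball_vol (real DIM('a)) * real DIM('a)) *
      (\<integral>\<^sup>+r\<in>{0..}. ?f r * ennreal (r ^ (DIM('a) - 1)) \<partial>lborel)"
    by (rule nn_integral_radial) measurable
  also have "(\<integral>\<^sup>+r\<in>{0..}. ?f r * ennreal (r ^ (DIM('a) - 1)) \<partial>lborel)
      = (\<integral>\<^sup>+r\<in>{1..}. L r * ennreal (1 / r\<^sup>2) \<partial>lborel)"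
  proof (intro nn_integral_cong)
    fix r :: real
    have "ennreal (1 / r ^ (DIM('a) + 1)) * ennreal (r ^ (DIM('a) - 1)) = ennreal (1 / r\<^sup>2)" if "1 \<le> r"
    proof -
      have "r ^ (DIM('a) + 1) = r ^ (DIM('a) - 1) * r\<^sup>2"
        by (simp flip: power_add)
      then show ?thesis using that by (simp flip: ennreal_mult)
    qed
    then show "?f r * ennreal (r ^ (DIM('a) - 1)) * indicator {0..} r = L r * ennreal (1 / r\<^sup>2) * indicator {1..} r"
      by (auto simp: indicator_def mult.assoc)
  qed
  finally show ?thesis using fin by (simp add: ennreal_mult_less_top)
qed

section \<open>Fourier transforms of compactly supported continuous functions\<close>

lemma compactly_supported_iff:
  "compactly_supported (f :: 'a::euclidean_space \<Rightarrow> complex) \<longleftrightarrow> (\<exists>R. \<forall>x. R < norm x \<longrightarrow> f x = 0)"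
proof
  assume "compactly_supported f"
  then have "bounded (support_on UNIV f)"
    using bounded_subset[OF compact_imp_bounded closure_subset]
    unfolding compactly_supported_def by blast
  then obtain R where R: "\<And>x. x \<in> support_on UNIV f \<Longrightarrow> norm x \<le> R"
    by (auto simp: bounded_iff)
  have "f x = 0" if "R < norm x" for x
    using R[of x] that by (auto simp: in_support_on)
  then show "\<exists>R. \<forall>x. R < norm x \<longrightarrow> f x = 0" by blast
next
  assume "\<exists>R. \<forall>x. R < norm x \<longrightarrow> f x = 0"
  then obtain R where "\<And>x. R < norm x \<Longrightarrow> f x = 0" by blast
  then have "support_on UNIV f \<subseteq> cball 0 R" by (force simp: in_support_on not_less[symmetric])
  then have "bounded (support_on UNIV f)" using bounded_cball bounded_subset by blast
  then show "compactly_supported f" by (simp add: compactly_supported_def compact_closure)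
qed

lemma compactly_supported_bound:
  fixes f :: "'a::euclidean_space \<Rightarrow> complex"
  assumes "compactly_supported f"
  obtains R where "0 < R" "\<And>x. R < norm x \<Longrightarrow> f x = 0"
proof -
  obtain R where "\<And>x. R < norm x \<Longrightarrow> f x = 0"
    using assms compactly_supported_iff by blast
  then show thesis by (intro that[of "max R 1"]) auto
qed

text \<open>Both kinds of integral are needed: the Fourier transform is a Lebesgue integral, whereas
Stone--Weierstrass and differentiation under the integral are used over a box.\<close>

lemma integral_continuous_cbox_support:
  fixes g :: "'a::euclidean_space \<Rightarrow> 'b::euclidean_space"
  assumes cont: "continuous_on UNIV g" and supp: "\<And>x. x \<notin> cbox a b \<Longrightarrow> g x = 0"
  shows "integral\<^sup>L lebesgue g = integral (cbox a b) g"
proof -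
  have eq: "g = (\<lambda>x. indicator (cbox a b) x *\<^sub>R g x)"
    using supp by (auto simp: indicator_def fun_eq_iff)
  have int: "integrable lborel g"
    by (subst eq, rule borel_integrable_compact) (use cont continuous_on_subset in auto)
  have "integral\<^sup>L lebesgue g = integral\<^sup>L lborel g"
    by (rule integral_completion) (use cont in \<open>auto intro: borel_measurable_continuous_onI\<close>)
  also have "\<dots> = integral UNIV g" using integral_lborel[OF int] by simp
  also have "\<dots> = integral UNIV (\<lambda>x. if x \<in> cbox a b then g x else 0)"
    by (rule arg_cong[of _ _ "integral UNIV"]) (use supp in auto)
  also have "\<dots> = integral (cbox a b) g" by (rule Henstock_Kurzweil_Integration.integral_restrict_UNIV)
  finally show "integral\<^sup>L lebesgue g = integral (cbox a b) g" .
qed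

lemma fourier_transform_cbox:
  fixes f :: "'a::euclidean_space \<Rightarrow> complex"
  assumes "continuous_on UNIV f" "\<And>x. x \<notin> cbox a b \<Longrightarrow> f x = 0"
  shows "fourier_transform f y = integral (cbox a b) (\<lambda>x. f x * exp (- (\<i> * complex_of_real (x \<bullet> y))))"
  unfolding fourier_transform_def
  by (rule integral_continuous_cbox_support) (use assms in \<open>auto intro!: continuous_intros\<close>)

text \<open>Real trigonometric polynomials with arbitrary real frequencies: the span of the functions against
which a vanishing Fourier transform is orthogonal.  Product-to-sum formulas make it an algebra, which is what the
Stone--Weierstrass theorem asks for.\<close>

inductive trig_poly :: "('a::real_inner \<Rightarrow> real) \<Rightarrow> bool" where
  wave: "trig_poly (\<lambda>x. a * cos (x \<bullet> y) + b * sin (x \<bullet> y))"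
| add: "trig_poly S \<Longrightarrow> trig_poly T \<Longrightarrow> trig_poly (\<lambda>x. S x + T x)"

lemma trig_poly_const: "trig_poly (\<lambda>x. c)"
  using trig_poly.wave[of c 0 0] by simp

lemma trig_poly_wave_mult:
  "trig_poly (\<lambda>x. (a * cos (x \<bullet> y) + b * sin (x \<bullet> y)) * (c * cos (x \<bullet> z) + d * sin (x \<bullet> z)))"
proof -
  have "trig_poly (\<lambda>x. ((a*c - b*d)/2 * cos (x \<bullet> (y + z)) + (b*c + a*d)/2 * sin (x \<bullet> (y + z)))
      + ((a*c + b*d)/2 * cos (x \<bullet> (y - z)) + (b*c - a*d)/2 * sin (x \<bullet> (y - z))))"
    by (intro trig_poly.intros)
  also have "(\<lambda>x. ((a*c - b*d)/2 * cos (x \<bullet> (y + z)) + (b*c + a*d)/2 * sin (x \<bullet> (y + z)))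
      + ((a*c + b*d)/2 * cos (x \<bullet> (y - z)) + (b*c - a*d)/2 * sin (x \<bullet> (y - z))))
     = (\<lambda>x. (a * cos (x \<bullet> y) + b * sin (x \<bullet> y)) * (c * cos (x \<bullet> z) + d * sin (x \<bullet> z)))"
    by (simp add: fun_eq_iff inner_add_right inner_diff_right cos_add cos_diff sin_add sin_diff field_simps)
  finally show ?thesis .
qed

lemma trig_poly_mult:
  assumes "trig_poly S" "trig_poly T"
  shows "trig_poly (\<lambda>x. S x * T x)"
  using assms
proof (induction S)
  case (wave a y b)
  from wave show ?case
  proof (induction T)
    case (wave c z d)
    show ?case by (rule trig_poly_wave_mult)
  next
    case (add S T)
    from trig_poly.add[OF add.IH] show ?case by (simp add: distrib_left)
  qed
next
  case (add S1 S2)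
  from trig_poly.add[OF add.IH(1,2)[OF add.prems]] show ?case by (simp add: distrib_right)
qed

lemma trig_poly_continuous: "trig_poly T \<Longrightarrow> continuous_on S T"
  by (induction rule: trig_poly.induct) (auto intro!: continuous_intros)

text \<open>The frequency \<open>w\<close> is chosen with \<open>(x - y) \<bullet> w = \<pi>\<close>, so that the wave \<open>exp (\<i> * (u \<bullet> w))\<close> has opposite
values at the two points.\<close>

lemma trig_poly_separates:
  fixes x y :: "'a::real_inner"
  assumes "x \<noteq> y"
  shows "\<exists>T. trig_poly T \<and> T x \<noteq> T y"
proof (rule ccontr)
  assume "\<not> ?thesis"
  then have eq: "T x = T y" if "trig_poly T" for T using that by blast
  define w where "w = (pi / (norm (x - y))\<^sup>2) *\<^sub>R (x - y)"
  have "cos (x \<bullet> w) = cos (y \<bullet> w)" "sin (x \<bullet> w) = sin (y \<bullet> w)"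
    using eq[OF trig_poly.wave[of 1 w 0]] eq[OF trig_poly.wave[of 0 w 1]] by simp_all
  then have "cos (x \<bullet> w - y \<bullet> w) = (cos (y \<bullet> w))\<^sup>2 + (sin (y \<bullet> w))\<^sup>2"
    by (simp add: cos_diff power2_eq_square)
  then have "cos (x \<bullet> w - y \<bullet> w) = 1" by simp
  moreover have "x \<bullet> w - y \<bullet> w = (x - y) \<bullet> w" by (simp add: inner_diff_left)
  moreover have "\<dots> = pi" using assms by (simp add: w_def dot_square_norm)
  ultimately show False by simp
qed

text \<open>By Stone--Weierstrass \<open>g\<close> is a uniform limit of trigonometric polynomials, hence orthogonal to
itself.\<close>

lemma zero_if_orthogonal_to_waves:
  fixes g :: "'a::euclidean_space \<Rightarrow> real"
  assumes cont: "continuous_on (cbox a b) g" and ne: "box a b \<noteq> {}"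
    and c: "\<And>y. integral (cbox a b) (\<lambda>x. g x * cos (x \<bullet> y)) = 0"
    and s: "\<And>y. integral (cbox a b) (\<lambda>x. g x * sin (x \<bullet> y)) = 0"
    and x: "x \<in> cbox a b"
  shows "g x = 0"
proof -
  let ?K = "cbox a b"
  have int: "u integrable_on ?K" if "continuous_on ?K u" for u :: "'a \<Rightarrow> real"
    by (rule integrable_continuous[OF that])
  have orth: "integral ?K (\<lambda>x. g x * T x) = 0" if "trig_poly T" for T
    using that
  proof induction
    case (wave \<alpha> y \<beta>)
    have "integral ?K (\<lambda>x. g x * (\<alpha> * cos (x \<bullet> y) + \<beta> * sin (x \<bullet> y)))
        = integral ?K (\<lambda>x. \<alpha> * (g x * cos (x \<bullet> y)) + \<beta> * (g x * sin (x \<bullet> y)))"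
      by (simp add: algebra_simps)
    also have "\<dots> = \<alpha> * integral ?K (\<lambda>x. g x * cos (x \<bullet> y)) + \<beta> * integral ?K (\<lambda>x. g x * sin (x \<bullet> y))"
      by (subst Henstock_Kurzweil_Integration.integral_add) (auto intro!: int continuous_intros cont)
    finally show ?case by (simp add: c s)
  next
    case (add S T)
    have "integral ?K (\<lambda>x. g x * S x + g x * T x)
        = integral ?K (\<lambda>x. g x * S x) + integral ?K (\<lambda>x. g x * T x)"
      by (rule Henstock_Kurzweil_Integration.integral_add)
        (intro int continuous_intros cont trig_poly_continuous[OF add.hyps(1)] trig_poly_continuous[OF add.hyps(2)])+
    then show ?case using add.IH by (simp add: distrib_left)
  qed
  define I where "I = integral ?K (\<lambda>x. \<bar>g x\<bar>)"
  have I: "0 \<le> I" unfolding I_def by (rule Henstock_Kurzweil_Integration.integral_nonneg) (auto intro!: int continuous_intros cont)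
  have "\<bar>integral ?K (\<lambda>x. g x * g x)\<bar> \<le> 0"
  proof (rule field_le_epsilon)
    fix e :: real assume "0 < e"
    define e' where "e' = e / (I + 1)"
    have e': "0 < e'" using \<open>0 < e\<close> I by (simp add: e'_def)
    obtain T where T: "trig_poly T" and close: "\<And>x. x \<in> ?K \<Longrightarrow> \<bar>g x - T x\<bar> < e'"
      using Stone_Weierstrass_HOL[of ?K trig_poly g e'] e'
      by (auto intro: trig_poly_const trig_poly_continuous trig_poly.add trig_poly_mult
          trig_poly_separates cont)
    have "integral ?K (\<lambda>x. g x * g x) = integral ?K (\<lambda>x. g x * (g x - T x)) + integral ?K (\<lambda>x. g x * T x)"
      by (subst Henstock_Kurzweil_Integration.integral_add[symmetric])
        (auto intro!: int continuous_intros cont trig_poly_continuous[OF T] simp: algebra_simps)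
    then have "\<bar>integral ?K (\<lambda>x. g x * g x)\<bar> = norm (integral ?K (\<lambda>x. g x * (g x - T x)))"
      by (simp add: orth[OF T])
    also have "\<dots> \<le> integral ?K (\<lambda>x. \<bar>g x\<bar> * e')"
      by (rule Henstock_Kurzweil_Integration.integral_norm_bound_integral)
        (use close in \<open>auto intro!: int continuous_intros cont trig_poly_continuous[OF T] mult_left_mono
          simp: abs_mult less_imp_le\<close>)
    also have "\<dots> = I * e'" by (simp add: I_def)
    also have "\<dots> \<le> e" using I \<open>0 < e\<close> by (simp add: e'_def field_simps)
    finally show "\<bar>integral ?K (\<lambda>x. g x * g x)\<bar> \<le> 0 + e" by simp
  qed
  then have "((\<lambda>x. g x * g x) has_integral 0) ?K"
    using integrable_integral[OF int[of "\<lambda>x. g x * g x"]] cont by (simp add: continuous_on_mult)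
  then have "g x * g x = 0"
    by (intro has_integral_0_cbox_imp_0[of a b "\<lambda>x. g x * g x"]) (auto intro!: continuous_intros cont ne x)
  then show ?thesis by simp
qed

lemma cball_subset_centred_cbox:
  "cball 0 R \<subseteq> cbox (- R *\<^sub>R One) (R *\<^sub>R (One :: 'a::euclidean_space))"
proof
  fix x :: 'a assume "x \<in> cball 0 R"
  then have "\<bar>x \<bullet> i\<bar> \<le> R" if "i \<in> Basis" for i using Basis_le_norm[OF that, of x] by simp
  then show "x \<in> cbox (- R *\<^sub>R One) (R *\<^sub>R One)" by (force simp: mem_box abs_le_iff)
qed

lemma zero_outside_centred_cbox:
  fixes f :: "'a::euclidean_space \<Rightarrow> complex"
  assumes "\<And>x. R < norm x \<Longrightarrow> f x = 0" and "x \<notin> cbox (- R *\<^sub>R One) (R *\<^sub>R One)"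
  shows "f x = 0"
proof (rule assms(1))
  have "x \<notin> cball 0 R" using assms(2) cball_subset_centred_cbox by blast
  then show "R < norm x" by simp
qed

text \<open>Frequencies \<open>y\<close> and \<open>- y\<close> together separate the cosine from the sine part of the transform, so the real and the
imaginary part of \<open>f\<close> are each orthogonal to all waves.\<close>

theorem fourier_transform_inject:
  fixes f :: "'a::euclidean_space \<Rightarrow> complex"
  assumes f: "f \<in> Cc" and zero: "\<And>y. fourier_transform f y = 0"
  shows "f x = 0"
proof -
  have cont: "continuous_on UNIV f" using f by (simp add: Cc_def)
  obtain R where R: "0 < R" "\<And>x. R < norm x \<Longrightarrow> f x = 0"
    using f compactly_supported_bound by (auto simp: Cc_def)
  define a b :: 'a where "a = - R *\<^sub>R One" and "b = R *\<^sub>R One"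
  have supp: "f x = 0" if "x \<notin> cbox a b" for x
    using zero_outside_centred_cbox[of R f x] R(2) that by (simp add: a_def b_def)
  have ne: "box a b \<noteq> {}" using R by (auto simp: box_ne_empty a_def b_def)
  have int: "u integrable_on cbox a b" if "continuous_on UNIV u" for u :: "'a \<Rightarrow> complex"
    by (rule integrable_continuous) (use that continuous_on_subset in blast)
  have ft: "integral (cbox a b) (\<lambda>x. f x * exp (- (\<i> * complex_of_real (x \<bullet> y)))) = 0" for y
    using fourier_transform_cbox[OF cont supp] zero by metis
  have i: "(\<lambda>x. f x * exp (- (\<i> * complex_of_real (x \<bullet> y)))) integrable_on cbox a b" for y
    by (intro int continuous_intros cont)
  have C: "integral (cbox a b) (\<lambda>x. f x * complex_of_real (cos (x \<bullet> y))) = 0" for y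
  proof -
    have "integral (cbox a b) (\<lambda>x. f x * exp (- (\<i> * complex_of_real (x \<bullet> y)))
        + f x * exp (- (\<i> * complex_of_real (x \<bullet> (- y))))) = 0"
      by (subst Henstock_Kurzweil_Integration.integral_add[OF i i]) (simp only: ft add_0)
    also have "(\<lambda>x. f x * exp (- (\<i> * complex_of_real (x \<bullet> y))) + f x * exp (- (\<i> * complex_of_real (x \<bullet> (- y)))))
       = (\<lambda>x. 2 * (f x * complex_of_real (cos (x \<bullet> y))))"
      by (simp add: fun_eq_iff cos_exp_eq cos_of_real[symmetric] algebra_simps)
    finally show ?thesis by simp
  qed
  have S: "integral (cbox a b) (\<lambda>x. f x * complex_of_real (sin (x \<bullet> y))) = 0" for y
  proof -
    have "integral (cbox a b) (\<lambda>x. f x * exp (- (\<i> * complex_of_real (x \<bullet> (-y))))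
        - f x * exp (- (\<i> * complex_of_real (x \<bullet> y)))) = 0"
      by (subst Henstock_Kurzweil_Integration.integral_diff[OF i i]) (simp only: ft diff_0_right)
    also have "(\<lambda>x. f x * exp (- (\<i> * complex_of_real (x \<bullet> (-y)))) - f x * exp (- (\<i> * complex_of_real (x \<bullet> y))))
       = (\<lambda>x. 2 * \<i> * (f x * complex_of_real (sin (x \<bullet> y))))"
      by (simp add: fun_eq_iff sin_exp_eq sin_of_real[symmetric] field_simps)
    finally show ?thesis by simp
  qed
  have Re0: "integral (cbox a b) (\<lambda>x. Re (u x)) = 0" and Im0: "integral (cbox a b) (\<lambda>x. Im (u x)) = 0"
    if "continuous_on UNIV u" "integral (cbox a b) u = 0" for u
    using integral_linear[OF int[OF that(1)] bounded_linear_Re] integral_linear[OF int[OF that(1)] bounded_linear_Im] that(2)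
    by (simp_all add: o_def)
  have cw: "continuous_on UNIV (\<lambda>x. f x * complex_of_real (cos (x \<bullet> y)))"
    "continuous_on UNIV (\<lambda>x. f x * complex_of_real (sin (x \<bullet> y)))" for y
    by (intro continuous_intros cont)+
  show ?thesis
  proof (cases "x \<in> cbox a b")
    case True
    have cr: "continuous_on (cbox a b) (\<lambda>x. Re (f x))" "continuous_on (cbox a b) (\<lambda>x. Im (f x))"
      by (intro continuous_intros continuous_on_subset[OF cont] subset_UNIV)+
    have "Re (f x) = 0"
      by (rule zero_if_orthogonal_to_waves[OF cr(1) ne _ _ True])
        (use Re0[OF cw(1) C] Re0[OF cw(2) S] in simp_all)
    moreover have "Im (f x) = 0"
      by (rule zero_if_orthogonal_to_waves[OF cr(2) ne _ _ True])
        (use Im0[OF cw(1) C] Im0[OF cw(2) S] in simp_all)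
    ultimately show ?thesis by (simp add: complex_eq_iff)
  qed (rule supp)
qed

text \<open>The easy half of the Paley--Wiener theorem, along one line through the origin.\<close>

lemma fourier_transform_line_entire:
  fixes f :: "'a::euclidean_space \<Rightarrow> complex"
  assumes f: "f \<in> Cc"
  obtains F :: "complex \<Rightarrow> complex" and A B :: real
  where "F holomorphic_on UNIV" "\<And>z. norm (F z) \<le> A * exp (B * \<bar>Im z\<bar>)"
    "\<And>r. F (of_real r) = fourier_transform f (r *\<^sub>R w)"
proof -
  have cont: "continuous_on UNIV f" using f by (simp add: Cc_def)
  obtain R where R: "0 < R" "\<And>x. R < norm x \<Longrightarrow> f x = 0"
    using f compactly_supported_bound by (auto simp: Cc_def)
  define a b :: 'a where "a = - R *\<^sub>R One" and "b = R *\<^sub>R One"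
  have supp: "f x = 0" if "x \<notin> cbox a b" for x
    using zero_outside_centred_cbox[of R f x] R(2) that by (simp add: a_def b_def)
  define F where "F z = integral (cbox a b) (\<lambda>x. f x * exp (- (\<i> * z * complex_of_real (x \<bullet> w))))" for z
  have contK: "continuous_on (cbox a b) f" using cont continuous_on_subset by blast
  have cont2: "continuous_on (UNIV \<times> cbox a b) (\<lambda>p. f (snd p))"
    by (rule continuous_on_compose2[OF cont]) (auto intro!: continuous_intros)
  have hol: "F holomorphic_on UNIV"
    unfolding F_def
  proof (rule leibniz_rule_holomorphic)
    show "((\<lambda>z. f x * exp (- (\<i> * z * complex_of_real (x \<bullet> w)))) has_field_derivative
        f x * (exp (- (\<i> * z * complex_of_real (x \<bullet> w))) * - (\<i> * complex_of_real (x \<bullet> w)))) (at z within UNIV)" for z x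
      by (auto intro!: derivative_eq_intros)
    show "(\<lambda>x. f x * exp (- (\<i> * z * complex_of_real (x \<bullet> w)))) integrable_on cbox a b" for z
      by (intro integrable_continuous continuous_intros contK)
    show "continuous_on (UNIV \<times> cbox a b)
       (\<lambda>(z, x). f x * (exp (- (\<i> * z * complex_of_real (x \<bullet> w))) * - (\<i> * complex_of_real (x \<bullet> w))))"
      unfolding split_beta by (intro continuous_intros cont2)
  qed simp
  define B where "B = R * norm w"
  define A where "A = integral (cbox a b) (\<lambda>x. norm (f x))"
  have bd: "norm (F z) \<le> A * exp (B * \<bar>Im z\<bar>)" for z
  proof -
    have "norm (F z) \<le> integral (cbox a b) (\<lambda>x. norm (f x) * exp (B * \<bar>Im z\<bar>))"
      unfolding F_def
    proof (rule Henstock_Kurzweil_Integration.integral_norm_bound_integral)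
      fix x
      show "norm (f x * exp (- (\<i> * z * complex_of_real (x \<bullet> w)))) \<le> norm (f x) * exp (B * \<bar>Im z\<bar>)"
      proof (cases "R < norm x")
        case False
        have "\<bar>x \<bullet> w\<bar> \<le> B"
          using Cauchy_Schwarz_ineq2[of x w] False mult_right_mono[of "norm x" R "norm w"] by (simp add: B_def)
        then have "\<bar>Im z\<bar> * \<bar>x \<bullet> w\<bar> \<le> \<bar>Im z\<bar> * B" by (rule mult_left_mono) simp
        then have "Im z * (x \<bullet> w) \<le> B * \<bar>Im z\<bar>"
          by (metis abs_ge_self abs_mult mult.commute order_trans)
        then show ?thesis by (simp add: norm_mult mult_left_mono)
      qed (simp add: R)
    qed (intro integrable_continuous continuous_intros contK)+
    then show ?thesis by (simp add: A_def)
  qed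
  have "F (of_real r) = fourier_transform f (r *\<^sub>R w)" for r
    by (simp add: F_def fourier_transform_cbox[OF cont supp] mult_ac)
  then show thesis using that hol bd by blast
qed

section \<open>Vanishing when the tail diverges\<close>

text \<open>It is enough to look at the transform along one line through the origin, in a direction \<open>w\<close> where it is assumed not to vanish.  There it extends to
an entire function \<open>F\<close> of exponential type, so \<open>L r = ln (M / norm (F r))\<close> has a finite
logarithmic integral.  The decay hypothesis on that line says \<open>\<theta> v \<le> L (norm v)\<close>, because \<open>\<theta>\<close> is radial, and
\<open>L\<close> is a Borel function: polar coordinates are applied to \<open>L\<close> rather than to \<open>\<theta>\<close>, whose profile need
not be Borel.\<close>

theorem vanishing_if_tail_diverges:
  fixes \<theta> :: "real ^ 'n \<Rightarrow> real" and f :: "real ^ 'n \<Rightarrow> complex"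
  assumes nn: "\<And>y. 0 \<le> \<theta> y" and rad: "radial \<theta>" and f: "f \<in> Cc"
    and C: "0 < C" "\<And>y. norm (fourier_transform f y) \<le> C * exp (- \<theta> y)"
    and div: "tail_integral \<theta> = \<infinity>"
  shows "f x = 0"
proof (rule fourier_transform_inject[OF f], rule ccontr)
  fix y assume y: "fourier_transform f y \<noteq> 0"
  define w where "w = (if y = 0 then axis undefined 1 else y /\<^sub>R norm y)"
  have w: "norm w = 1" and yw: "y = norm y *\<^sub>R w" by (auto simp: w_def)
  obtain F A B where F: "F holomorphic_on UNIV" "\<And>z. norm (F z) \<le> A * exp (B * \<bar>Im z\<bar>)"
    and Ff: "\<And>r. F (of_real r) = fourier_transform f (r *\<^sub>R w)"
    using fourier_transform_line_entire[OF f] by metis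
  define M where "M = max A C"
  have M: "0 < M" "A \<le> M" "C \<le> M" using C by (auto simp: M_def)
  define L where "L r = (if F (of_real r) = 0 then \<infinity> else ennreal (ln (M / norm (F (of_real r)))))" for r :: real
  have "F (of_real (norm y)) \<noteq> 0" using y yw by (simp add: Ff)
  then have fin: "(\<integral>\<^sup>+r\<in>{1..}. L r * ennreal (1 / r\<^sup>2) \<partial>lborel) < \<infinity>"
    unfolding L_def by (intro log_integral_finite[OF F] M)
  have [measurable]: "(\<lambda>r::real. F (of_real r)) \<in> borel_measurable borel"
    by (rule borel_measurable_continuous_onI)
      (auto intro!: continuous_on_compose2[OF holomorphic_on_imp_continuous_on[OF F(1)]] continuous_intros)
  have [measurable]: "L \<in> borel_measurable borel" unfolding L_def by measurable
  have \<theta>L: "ennreal (\<theta> v) \<le> L (norm v)" for v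
  proof (cases "F (of_real (norm v)) = 0")
    case False
    have "norm (norm v *\<^sub>R w) = norm v" using w by simp
    then have "\<theta> (norm v *\<^sub>R w) = \<theta> v" using rad unfolding radial_def by metis
    then have "norm (F (of_real (norm v))) \<le> C * exp (- \<theta> v)" using C(2) by (metis Ff)
    also have "\<dots> \<le> M * exp (- \<theta> v)" using M by simp
    finally have "exp (\<theta> v) \<le> M / norm (F (of_real (norm v)))"
      using False by (simp add: exp_minus field_simps)
    then have "\<theta> v \<le> ln (M / norm (F (of_real (norm v))))"
      using False M by (subst ln_ge_iff) auto
    then show ?thesis using False by (simp add: L_def ennreal_leI)
  qed (simp add: L_def)
  have "tail_integral \<theta> \<le> (\<integral>\<^sup>+v\<in>{v::real^'n. 1 \<le> norm v}. L (norm v) * ennreal (1 / norm v ^ (CARD('n) + 1)) \<partial>lebesgue)"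
    unfolding tail_integral_def
  proof (intro nn_integral_mono mult_right_mono)
    fix v
    have "ennreal (\<theta> v / norm v ^ (CARD('n) + 1)) = ennreal (\<theta> v) * ennreal (1 / norm v ^ (CARD('n) + 1))"
      using nn by (simp flip: ennreal_mult)
    also have "\<dots> \<le> L (norm v) * ennreal (1 / norm v ^ (CARD('n) + 1))"
      by (intro mult_right_mono \<theta>L) simp
    finally show "ennreal (\<theta> v / norm v ^ (CARD('n) + 1)) \<le> L (norm v) * ennreal (1 / norm v ^ (CARD('n) + 1))" .
  qed simp
  also have "\<dots> < \<infinity>"
    using radial_weighted_tail_finite[where 'a = "real^'n", OF _ fin] by (simp add: nn_integral_completion)
  finally show False using div by simp
qed

section \<open>Rotation invariance\<close>

text \<open>The uniqueness argument for Haar measure.  The image \<open>\<mu>\<close> of Lebesgue measure is translation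
invariant; evaluating the double integral of \<open>indicator B y * indicator A (y + x)\<close> in both orders, with
\<open>B\<close> the unit ball, shows that \<open>\<mu>\<close> and Lebesgue measure differ by the factor
\<open>\<mu> B / lborel B\<close>.  An isometry maps \<open>B\<close> to itself, so the factor is one.\<close>

theorem lborel_distr_orthogonal_transformation:
  fixes Q :: "'a::euclidean_space \<Rightarrow> 'a"
  assumes Q: "orthogonal_transformation Q"
  shows "distr lborel borel Q = lborel"
proof -
  have lin: "linear Q" and nQ: "norm (Q x) = norm x" for x
    using Q by (auto simp: orthogonal_transformation)
  have "continuous_on UNIV Q" using lin by (simp add: linear_continuous_on linear_conv_bounded_linear)
  then have [measurable]: "Q \<in> borel \<rightarrow>\<^sub>M borel" by (rule borel_measurable_continuous_onI)
  define \<mu> where "\<mu> = distr lborel borel Q"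
  have sets\<mu> [measurable_cong, simp]: "sets \<mu> = sets borel" by (simp add: \<mu>_def)
  have ball: "emeasure \<mu> (cball 0 r) = emeasure lborel (cball (0::'a) r)" for r
    unfolding \<mu>_def by (subst emeasure_distr) (auto simp: vimage_def cball_def nQ)
  have shift: "(\<integral>\<^sup>+x. f (a + x) \<partial>\<mu>) = (\<integral>\<^sup>+x. f x \<partial>\<mu>)"
    if [measurable]: "f \<in> borel_measurable borel" for f :: "'a \<Rightarrow> ennreal" and a
  proof -
    obtain c where a: "a = Q c" using Q by (metis orthogonal_transformation_surj surj_def)
    have "(\<integral>\<^sup>+x. f (a + x) \<partial>\<mu>) = (\<integral>\<^sup>+x. f (Q (c + x)) \<partial>lborel)"
      unfolding \<mu>_def by (subst nn_integral_distr) (auto simp: a linear_add[OF lin])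
    also have "\<dots> = (\<integral>\<^sup>+x. f (Q x) \<partial>distr lborel borel ((+) c))"
      by (subst nn_integral_distr) auto
    also have "\<dots> = (\<integral>\<^sup>+x. f x \<partial>\<mu>)"
      unfolding lborel_distr_plus \<mu>_def by (subst nn_integral_distr) auto
    finally show ?thesis .
  qed
  have shiftl: "(\<integral>\<^sup>+x. f (a + x) \<partial>lborel) = (\<integral>\<^sup>+x. f x \<partial>lborel)"
    if [measurable]: "f \<in> borel_measurable borel" for f :: "'a \<Rightarrow> ennreal" and a
  proof -
    have "(\<integral>\<^sup>+x. f x \<partial>distr lborel borel ((+) a)) = (\<integral>\<^sup>+x. f (a + x) \<partial>lborel)"
      by (subst nn_integral_distr) auto
    then show ?thesis unfolding lborel_distr_plus by simp
  qed
  interpret \<mu>: sigma_finite_measure \<mu>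
  proof
    show "\<exists>A. countable A \<and> A \<subseteq> sets \<mu> \<and> \<Union> A = space \<mu> \<and> (\<forall>a\<in>A. emeasure \<mu> a \<noteq> \<infinity>)"
    proof (intro exI[of _ "range (\<lambda>n::nat. cball 0 (real n))"] conjI ballI)
      show "\<Union> (range (\<lambda>n::nat. cball 0 (real n))) = space \<mu>"
        using real_arch_simple by (auto simp: \<mu>_def)
      show "emeasure \<mu> X \<noteq> \<infinity>" if "X \<in> range (\<lambda>n::nat. cball 0 (real n))" for X
        using that by (auto simp: ball emeasure_cball)
    qed auto
  qed
  interpret pair_sigma_finite \<mu> lborel ..
  define B :: "'a set" where "B = cball 0 1"
  have [measurable]: "B \<in> sets borel" by (simp add: B_def)
  have "emeasure \<mu> A = emeasure lborel A" if A [measurable]: "A \<in> sets borel" for A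
  proof -
    let ?i = "indicator :: 'a set \<Rightarrow> 'a \<Rightarrow> ennreal"
    have "emeasure lborel B * emeasure \<mu> A = (\<integral>\<^sup>+y. ?i B y * (\<integral>\<^sup>+x. ?i A x \<partial>\<mu>) \<partial>lborel)"
      by (subst nn_integral_multc) auto
    also have "\<dots> = (\<integral>\<^sup>+y. (\<integral>\<^sup>+x. ?i B y * ?i A (y + x) \<partial>\<mu>) \<partial>lborel)"
      by (intro nn_integral_cong) (simp add: nn_integral_cmult shift)
    also have "\<dots> = (\<integral>\<^sup>+x. (\<integral>\<^sup>+y. ?i B y * ?i A (y + x) \<partial>lborel) \<partial>\<mu>)"
      by (rule Fubini') measurable
    also have "\<dots> = (\<integral>\<^sup>+x. (\<integral>\<^sup>+y. ?i B (y - x) * ?i A y \<partial>lborel) \<partial>\<mu>)"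
    proof (rule nn_integral_cong)
      fix x
      have "(\<integral>\<^sup>+y. ?i B (x + y - x) * ?i A (x + y) \<partial>lborel) = (\<integral>\<^sup>+y. ?i B (y - x) * ?i A y \<partial>lborel)"
        by (rule shiftl) measurable
      then show "(\<integral>\<^sup>+y. ?i B y * ?i A (y + x) \<partial>lborel) = (\<integral>\<^sup>+y. ?i B (y - x) * ?i A y \<partial>lborel)"
        by (simp add: add.commute)
    qed
    also have "\<dots> = (\<integral>\<^sup>+y. (\<integral>\<^sup>+x. ?i B (y - x) * ?i A y \<partial>\<mu>) \<partial>lborel)"
      by (rule Fubini'[symmetric]) measurable
    also have "\<dots> = (\<integral>\<^sup>+y. emeasure \<mu> B * ?i A y \<partial>lborel)"
    proof (rule nn_integral_cong)
      fix y
      have "(\<integral>\<^sup>+x. ?i B (y - x) * ?i A y \<partial>\<mu>) = (\<integral>\<^sup>+x. ?i B (- y + x) \<partial>\<mu>) * ?i A y"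
        by (subst nn_integral_multc) (auto intro!: arg_cong2[of _ _ _ _ "(*)"] nn_integral_cong
            simp: B_def indicator_def norm_minus_commute)
      also have "(\<integral>\<^sup>+x. ?i B (- y + x) \<partial>\<mu>) = emeasure \<mu> B"
        by (subst shift) auto
      finally show "(\<integral>\<^sup>+x. ?i B (y - x) * ?i A y \<partial>\<mu>) = emeasure \<mu> B * ?i A y" .
    qed
    also have "\<dots> = emeasure \<mu> B * emeasure lborel A" by (subst nn_integral_cmult) auto
    also have "emeasure \<mu> B = emeasure lborel B" by (simp add: B_def ball)
    finally have "emeasure lborel B * emeasure \<mu> A = emeasure lborel B * emeasure lborel A" .
    moreover have "0 < emeasure lborel B" "emeasure lborel B < \<infinity>"
      by (auto simp: B_def emeasure_cball unit_ball_vol_pos)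
    ultimately show ?thesis by (auto simp: ennreal_mult_cancel_left)
  qed
  then show ?thesis unfolding \<mu>_def[symmetric] by (intro measure_eqI) auto
qed

lemma integral_orthogonal_transformation:
  fixes Q :: "'a::euclidean_space \<Rightarrow> 'a" and f :: "'a \<Rightarrow> complex"
  assumes Q: "orthogonal_transformation Q" and [measurable]: "f \<in> borel_measurable borel"
  shows "(\<integral>x. f (Q x) \<partial>lborel) = (\<integral>x. f x \<partial>lborel)"
proof -
  have "linear Q" using Q by (simp add: orthogonal_transformation_linear)
  then have "continuous_on UNIV Q" by (simp add: linear_continuous_on linear_conv_bounded_linear)
  then have [measurable]: "Q \<in> borel \<rightarrow>\<^sub>M borel" by (rule borel_measurable_continuous_onI)
  have "(\<integral>x. f x \<partial>distr lborel borel Q) = (\<integral>x. f (Q x) \<partial>lborel)"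
    by (rule integral_distr) auto
  then show ?thesis by (simp add: lborel_distr_orthogonal_transformation[OF Q])
qed

lemma fourier_transform_orthogonal:
  fixes Q :: "'a::euclidean_space \<Rightarrow> 'a" and f :: "'a::euclidean_space \<Rightarrow> complex"
  assumes Q: "orthogonal_transformation Q" and cont: "continuous_on UNIV f"
  shows "fourier_transform (\<lambda>x. f (Q x)) y = fourier_transform f (Q y)"
proof -
  have contQ: "continuous_on UNIV Q"
    using Q by (simp add: linear_continuous_on linear_conv_bounded_linear[symmetric] orthogonal_transformation_linear)
  have inner: "Q x \<bullet> Q y = x \<bullet> y" for x using Q by (simp add: orthogonal_transformation_def)
  have cf: "continuous_on UNIV (\<lambda>x. f (Q x))" by (rule continuous_on_compose2[OF cont contQ]) auto
  have "fourier_transform (\<lambda>x. f (Q x)) y = (\<integral>x. f (Q x) * exp (- (\<i> * complex_of_real (Q x \<bullet> Q y))) \<partial>lborel)"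
    unfolding fourier_transform_def inner
    by (rule integral_completion) (use cf in \<open>auto intro!: borel_measurable_continuous_onI continuous_intros\<close>)
  also have "\<dots> = (\<integral>x. f x * exp (- (\<i> * complex_of_real (x \<bullet> Q y))) \<partial>lborel)"
    by (rule integral_orthogonal_transformation[OF Q]) (intro borel_measurable_continuous_onI continuous_intros cont)
  also have "\<dots> = fourier_transform f (Q y)"
    unfolding fourier_transform_def
    by (rule integral_completion[symmetric]) (use cont in \<open>auto intro!: borel_measurable_continuous_onI continuous_intros\<close>)
  finally show ?thesis .
qed

lemma Cc_diff:
  assumes "f \<in> Cc" "g \<in> Cc"
  shows "(\<lambda>x. f x - g x) \<in> Cc"
proof -
  obtain R S where "\<And>x. R < norm x \<Longrightarrow> f x = 0" "\<And>x. S < norm x \<Longrightarrow> g x = 0"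
    using assms by (auto simp: Cc_def compactly_supported_iff)
  then have "compactly_supported (\<lambda>x. f x - g x)"
    unfolding compactly_supported_iff by (intro exI[of _ "max R S"]) simp
  then show ?thesis
    using assms unfolding Cc_def by (auto intro!: continuous_intros)
qed

lemma Cc_orthogonal:
  fixes Q :: "'a::euclidean_space \<Rightarrow> 'a"
  assumes f: "f \<in> Cc" and Q: "orthogonal_transformation Q"
  shows "(\<lambda>x. f (Q x)) \<in> Cc"
proof -
  have "continuous_on UNIV Q"
    using Q by (simp add: linear_continuous_on linear_conv_bounded_linear[symmetric] orthogonal_transformation_linear)
  then have "continuous_on UNIV (\<lambda>x. f (Q x))"
    using f by (auto simp: Cc_def intro: continuous_on_compose2)
  moreover obtain R where "\<And>x. R < norm x \<Longrightarrow> f x = 0"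
    using f by (auto simp: Cc_def compactly_supported_iff)
  then have "compactly_supported (\<lambda>x. f (Q x))"
    using Q unfolding compactly_supported_iff orthogonal_transformation by (intro exI[of _ R]) simp
  ultimately show ?thesis by (simp add: Cc_def)
qed

lemma fourier_transform_diff:
  fixes f g :: "'a::euclidean_space \<Rightarrow> complex"
  assumes "f \<in> Cc" "g \<in> Cc"
  shows "fourier_transform (\<lambda>x. f x - g x) y = fourier_transform f y - fourier_transform g y"
proof -
  obtain R S where RS: "\<And>x. R < norm x \<Longrightarrow> f x = 0" "\<And>x. S < norm x \<Longrightarrow> g x = 0"
    using assms by (auto simp: Cc_def compactly_supported_iff)
  define T where "T = max R S"
  define a b :: 'a where "a = - T *\<^sub>R One" and "b = T *\<^sub>R One"
  have supp: "f x = 0" "g x = 0" if "x \<notin> cbox a b" for x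
    using zero_outside_centred_cbox[of T f x] zero_outside_centred_cbox[of T g x] RS that
    by (simp_all add: a_def b_def T_def)
  have cont: "continuous_on UNIV f" "continuous_on UNIV g" using assms by (auto simp: Cc_def)
  have contK: "continuous_on (cbox a b) f" "continuous_on (cbox a b) g"
    using cont continuous_on_subset by blast+
  have "fourier_transform (\<lambda>x. f x - g x) y = integral (cbox a b)
      (\<lambda>x. f x * exp (- (\<i> * complex_of_real (x \<bullet> y))) - g x * exp (- (\<i> * complex_of_real (x \<bullet> y))))"
    using supp by (subst fourier_transform_cbox[of _ a b]) (auto intro!: continuous_intros cont simp: left_diff_distrib)
  also have "\<dots> = integral (cbox a b) (\<lambda>x. f x * exp (- (\<i> * complex_of_real (x \<bullet> y))))
      - integral (cbox a b) (\<lambda>x. g x * exp (- (\<i> * complex_of_real (x \<bullet> y))))"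
    by (intro Henstock_Kurzweil_Integration.integral_diff integrable_continuous continuous_intros contK)
  also have "\<dots> = fourier_transform f y - fourier_transform g y"
    using fourier_transform_cbox[OF cont(1) supp(1)] fourier_transform_cbox[OF cont(2) supp(2)] by simp
  finally show ?thesis .
qed

text \<open>Radiality can be read off the transform: \<open>f \<circ> Q - f\<close> has vanishing transform for every orthogonal \<open>Q\<close>.\<close>

lemma radial_if_fourier_transform_invariant:
  fixes f :: "real ^ 'n \<Rightarrow> complex"
  assumes f: "f \<in> Cc"
    and inv: "\<And>Q y. orthogonal_transformation Q \<Longrightarrow> fourier_transform f (Q y) = fourier_transform f y"
  shows "radial f"
proof -
  have cont: "continuous_on UNIV f" using f by (simp add: Cc_def)
  have eq: "f x = f y" if "norm x = norm y" for x y
  proof -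
    obtain Q where Q: "orthogonal_transformation Q" "Q x = y"
      using orthogonal_transformation_exists[OF \<open>norm x = norm y\<close>] by blast
    have "f (Q x) - f x = 0"
    proof (rule fourier_transform_inject[of "\<lambda>x. f (Q x) - f x"])
      show "(\<lambda>x. f (Q x) - f x) \<in> Cc" by (rule Cc_diff[OF Cc_orthogonal[OF f Q(1)] f])
      show "fourier_transform (\<lambda>x. f (Q x) - f x) z = 0" for z
        by (simp add: fourier_transform_diff[OF Cc_orthogonal[OF f Q(1)] f]
            fourier_transform_orthogonal[OF Q(1) cont] inv[OF Q(1)])
    qed
    then show ?thesis using Q by simp
  qed
  have "f y = f (norm y *\<^sub>R axis undefined 1)" for y by (rule eq) simp
  then show ?thesis unfolding radial_def by (intro exI[of _ "\<lambda>r. f (r *\<^sub>R axis undefined 1)"]) blast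
qed

section \<open>A smooth bump function\<close>

text \<open>The functions \<open>q (1/t) * exp (- 1/t)\<close>, extended by zero to \<open>t \<le> 0\<close>.  Carrying the polynomial \<open>q\<close>
along makes the family closed under differentiation.\<close>

definition flat :: "real poly \<Rightarrow> real \<Rightarrow> real" where
  "flat q t = (if 0 < t then poly q (1 / t) * exp (- (1 / t)) else 0)"

lemma poly_times_exp_minus_tendsto_0: "((\<lambda>s. poly p s * exp (- s)) \<longlongrightarrow> (0::real)) at_top"
proof -
  have "((\<lambda>s. \<Sum>i\<le>degree p. coeff p i * (s ^ i / exp s)) \<longlongrightarrow> (\<Sum>i\<le>degree p. coeff p i * 0)) at_top"
    by (intro tendsto_intros tendsto_power_div_exp_0)
  then show ?thesis
    by (simp add: poly_altdef sum_distrib_right exp_minus divide_inverse mult.assoc)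
qed

lemma flat_tendsto_0: "(flat q \<longlongrightarrow> 0) (at 0)"
proof -
  have "((\<lambda>t. poly q (inverse t) * exp (- inverse t)) \<longlongrightarrow> 0) (at_right 0)"
    using filterlim_compose[OF poly_times_exp_minus_tendsto_0 filterlim_inverse_at_top_right] .
  then have "(flat q \<longlongrightarrow> 0) (at_right 0)"
    by (rule Lim_transform_eventually)
      (auto simp: eventually_at_filter flat_def inverse_eq_divide)
  moreover have "(flat q \<longlongrightarrow> 0) (at_left 0)"
    by (rule tendsto_eventually) (auto simp: eventually_at_filter flat_def)
  ultimately show ?thesis by (simp add: filterlim_split_at)
qed

definition flat_deriv :: "real poly \<Rightarrow> real poly" where
  "flat_deriv q = [:0, 0, 1:] * (q - pderiv q)"

text \<open>At the origin the difference quotient of \<open>flat q\<close> is again a member of the family, for the polynomial \<open>X * q\<close>, and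
hence tends to zero.\<close>

lemma has_derivative_flat: "(flat q has_real_derivative flat (flat_deriv q) t) (at t)"
proof (cases t "0::real" rule: linorder_cases)
  case less
  then have "\<forall>\<^sub>F s in nhds t. flat q s = 0"
    using eventually_nhds_in_open[of "{..<0}" t] by (auto simp: flat_def elim!: eventually_mono)
  then have "(flat q has_real_derivative 0) (at t) \<longleftrightarrow> ((\<lambda>_. 0) has_real_derivative 0) (at t)"
    by (intro DERIV_cong_ev) auto
  then show ?thesis using less by (simp add: flat_def)
next
  case equal
  have "((\<lambda>s. (flat q s - flat q 0) / (s - 0)) \<longlongrightarrow> 0) (at 0)"
  proof (rule Lim_transform_eventually[OF flat_tendsto_0[of "pCons 0 q"]])
    show "\<forall>\<^sub>F s in at 0. flat (pCons 0 q) s = (flat q s - flat q 0) / (s - 0)"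
      by (auto simp: eventually_at_filter flat_def)
  qed
  then show ?thesis using equal by (simp add: has_field_derivative_iff flat_def)
next
  case greater
  then have "\<forall>\<^sub>F s in nhds t. flat q s = poly q (1 / s) * exp (- (1 / s))"
    using eventually_nhds_in_open[of "{0<..}" t] by (auto simp: flat_def elim!: eventually_mono)
  then have "(flat q has_real_derivative flat (flat_deriv q) t) (at t) \<longleftrightarrow>
      ((\<lambda>s. poly q (1 / s) * exp (- (1 / s))) has_real_derivative flat (flat_deriv q) t) (at t)"
    by (intro DERIV_cong_ev) auto
  moreover have "((\<lambda>s. poly q (1 / s) * exp (- (1 / s))) has_real_derivative flat (flat_deriv q) t) (at t)"
    using greater
    by (auto intro!: derivative_eq_intros DERIV_chain2[OF poly_DERIV]
        simp: flat_def flat_deriv_def field_simps power2_eq_square)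
  ultimately show ?thesis by simp
qed

text \<open>The functions that arise when \<open>flat q (1 - x \<bullet> x)\<close> is differentiated repeatedly are obtained from
functions of the same shape by these operations.\<close>

inductive bump_like :: "('a::real_inner \<Rightarrow> real) \<Rightarrow> bool" where
  flat: "bump_like (\<lambda>x. flat q (1 - x \<bullet> x))"
| inner_mult: "bump_like \<phi> \<Longrightarrow> bump_like (\<lambda>x. (x \<bullet> v) * \<phi> x)"
| cmult: "bump_like \<phi> \<Longrightarrow> bump_like (\<lambda>x. c * \<phi> x)"
| add: "bump_like \<phi> \<Longrightarrow> bump_like \<psi> \<Longrightarrow> bump_like (\<lambda>x. \<phi> x + \<psi> x)"

lemma bump_like_derivative:
  assumes "bump_like \<phi>"
  shows "\<exists>D. (\<forall>x. (\<phi> has_derivative D x) (at x)) \<and> (\<forall>v. bump_like (\<lambda>x. D x v))"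
  using assms
proof induction
  case (flat q)
  show ?case
  proof (intro exI[of _ "\<lambda>x h. - 2 * ((x \<bullet> h) * flat (flat_deriv q) (1 - x \<bullet> x))"] conjI allI)
    show "bump_like (\<lambda>x. - 2 * ((x \<bullet> v) * flat (flat_deriv q) (1 - x \<bullet> x)))" for v :: 'a
      by (intro bump_like.intros)
    fix x :: 'a
    have "((\<lambda>x. 1 - x \<bullet> x) has_derivative (\<lambda>h. - 2 * (x \<bullet> h))) (at x)"
      by (auto intro!: derivative_eq_intros simp: inner_commute)
    from DERIV_compose_FDERIV[OF has_derivative_flat this]
    show "((\<lambda>x. flat q (1 - x \<bullet> x)) has_derivative (\<lambda>h. - 2 * ((x \<bullet> h) * flat (flat_deriv q) (1 - x \<bullet> x)))) (at x)"
      by (simp add: mult.assoc)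
  qed
next
  case (inner_mult \<phi> v)
  then obtain D where D: "\<And>x. (\<phi> has_derivative D x) (at x)" "\<And>v. bump_like (\<lambda>x. D x v)" by blast
  show ?case
  proof (intro exI[of _ "\<lambda>x h. (x \<bullet> v) * D x h + (h \<bullet> v) * \<phi> x"] conjI allI)
    show "bump_like (\<lambda>x. (x \<bullet> v) * D x h + (h \<bullet> v) * \<phi> x)" for h
      by (intro bump_like.intros D inner_mult.hyps)
    show "((\<lambda>x. (x \<bullet> v) * \<phi> x) has_derivative (\<lambda>h. (x \<bullet> v) * D x h + (h \<bullet> v) * \<phi> x)) (at x)" for x
      by (auto intro!: derivative_eq_intros D)
  qed
next
  case (cmult \<phi> c)
  then obtain D where D: "\<And>x. (\<phi> has_derivative D x) (at x)" "\<And>v. bump_like (\<lambda>x. D x v)" by blast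
  show ?case
    by (intro exI[of _ "\<lambda>x h. c * D x h"] conjI allI bump_like.intros D has_derivative_mult_right)
next
  case (add \<phi> \<psi>)
  then obtain D E where D: "\<And>x. (\<phi> has_derivative D x) (at x)" "\<And>v. bump_like (\<lambda>x. D x v)"
    and E: "\<And>x. (\<psi> has_derivative E x) (at x)" "\<And>v. bump_like (\<lambda>x. E x v)" by blast
  show ?case
    by (intro exI[of _ "\<lambda>x h. D x h + E x h"] conjI allI bump_like.intros D E has_derivative_add)
qed

text \<open>To be smooth it suffices to lie in some class of functions that is closed under directional
derivatives.\<close>

lemma C_diff_coinduct:
  assumes "\<phi> \<in> S"
    and step: "\<And>\<phi>. \<phi> \<in> S \<Longrightarrow> \<exists>D. (\<forall>x. (\<phi> has_derivative D x) (at x)) \<and> (\<forall>v. (\<lambda>x. D x v) \<in> S)"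
  shows "C_diff k \<phi>"
  using \<open>\<phi> \<in> S\<close>
proof (induction k arbitrary: \<phi>)
  case 0
  from step[OF this] show ?case
    by (auto simp: continuous_on_eq_continuous_at intro: has_derivative_continuous)
next
  case (Suc k)
  from step[OF this(2)] obtain D where D: "\<And>x. (\<phi> has_derivative D x) (at x)" "\<And>v. (\<lambda>x. D x v) \<in> S"
    by blast
  have "frechet_derivative \<phi> (at x) = D x" for x
    using frechet_derivative_at[OF D(1)] by simp
  then show ?case using D Suc.IH by (auto simp: differentiable_def)
qed

definition bump :: "'a::euclidean_space \<Rightarrow> real" where
  "bump x = flat 1 (1 - x \<bullet> x)"

lemma bump_nonneg: "0 \<le> bump x"
  by (simp add: bump_def flat_def)

lemma bump_0_pos: "0 < bump 0"
  by (simp add: bump_def flat_def)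

lemma bump_eq_0: "1 \<le> norm x \<Longrightarrow> bump x = 0"
proof -
  assume "1 \<le> norm x"
  then have "1 \<le> (norm x)\<^sup>2" by (rule one_le_power)
  then show ?thesis by (simp add: bump_def flat_def dot_square_norm)
qed

lemma bump_norm_cong: "norm x = norm y \<Longrightarrow> bump x = bump y"
  by (simp add: bump_def dot_square_norm)

lemma C_diff_bump: "C_diff k (\<lambda>x. complex_of_real (bump x))"
proof (rule C_diff_coinduct[where S = "{\<lambda>x. complex_of_real (\<phi> x) | \<phi>. bump_like \<phi>}"])
  show "(\<lambda>x. complex_of_real (bump x)) \<in> {\<lambda>x. complex_of_real (\<phi> x) | \<phi>. bump_like \<phi>}"
    unfolding bump_def by (intro CollectI exI[of _ "\<lambda>x. flat 1 (1 - x \<bullet> x)"] conjI refl bump_like.flat)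
  fix \<phi>c :: "'a \<Rightarrow> complex" assume "\<phi>c \<in> {\<lambda>x. complex_of_real (\<phi> x) | \<phi>. bump_like \<phi>}"
  then obtain \<phi> where \<phi>: "\<phi>c = (\<lambda>x. complex_of_real (\<phi> x))" "bump_like \<phi>" by blast
  obtain D where D: "\<And>x. (\<phi> has_derivative D x) (at x)" "\<And>v. bump_like (\<lambda>x. D x v)"
    using bump_like_derivative[OF \<phi>(2)] by blast
  show "\<exists>D. (\<forall>x. (\<phi>c has_derivative D x) (at x)) \<and>
      (\<forall>v. (\<lambda>x. D x v) \<in> {\<lambda>x. complex_of_real (\<phi> x) | \<phi>. bump_like \<phi>})"
    using D unfolding \<phi>(1)
    by (intro exI[of _ "\<lambda>x h. complex_of_real (D x h)"]) (auto intro!: has_derivative_of_real)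
qed

section \<open>Averages over bounded random translations\<close>

text \<open>Smooth functions supported in the closed unit ball; a fixed ball makes the class closed under
differentiation and gives uniform bounds on all derivatives.\<close>

definition smooth_on_unit_ball :: "('a::euclidean_space \<Rightarrow> complex) set" where
  "smooth_on_unit_ball = {\<phi>. (\<forall>k. C_diff k \<phi>) \<and> (\<forall>x. 1 < norm x \<longrightarrow> \<phi> x = 0)}"

lemma smooth_on_unit_ball_continuous: "\<phi> \<in> smooth_on_unit_ball \<Longrightarrow> continuous_on S \<phi>"
proof -
  assume "\<phi> \<in> smooth_on_unit_ball"
  then have "C_diff 0 \<phi>" unfolding smooth_on_unit_ball_def by blast
  then show ?thesis using continuous_on_subset[OF _ subset_UNIV] by simp
qed

lemma smooth_on_unit_ball_derivative:
  assumes \<phi>: "\<phi> \<in> smooth_on_unit_ball"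
  obtains D where "\<And>x. (\<phi> has_derivative D x) (at x)" "\<And>v. (\<lambda>x. D x v) \<in> smooth_on_unit_ball"
proof
  have C: "C_diff (Suc k) \<phi>" for k using \<phi> by (simp add: smooth_on_unit_ball_def del: C_diff.simps)
  show D: "(\<phi> has_derivative frechet_derivative \<phi> (at x)) (at x)" for x
    using C[of 0] by (simp add: frechet_derivative_works[symmetric])
  have "frechet_derivative \<phi> (at x) v = 0" if "1 < norm x" for x v
  proof -
    have "open {x::'a. 1 < norm x}" by (intro open_Collect_less continuous_intros)
    then have "((\<lambda>_. 0) has_derivative frechet_derivative \<phi> (at x)) (at x)"
      by (rule has_derivative_transform_within_open[OF D])
        (use that \<phi> in \<open>auto simp: smooth_on_unit_ball_def\<close>)
    then have "frechet_derivative \<phi> (at x) = (\<lambda>_. 0)"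
      using has_derivative_unique[OF _ has_derivative_const] by blast
    then show ?thesis by simp
  qed
  then show "(\<lambda>x. frechet_derivative \<phi> (at x) v) \<in> smooth_on_unit_ball" for v
    using C by (auto simp: smooth_on_unit_ball_def)
qed

lemma smooth_on_unit_ball_bounded:
  assumes \<phi>: "\<phi> \<in> smooth_on_unit_ball"
  obtains B where "0 \<le> B" "\<And>x. norm (\<phi> x) \<le> B"
proof -
  have "bounded (\<phi> ` cball 0 1)"
    by (intro compact_imp_bounded compact_continuous_image smooth_on_unit_ball_continuous \<phi> compact_cball)
  then obtain B where B: "0 < B" "\<And>x. norm x \<le> 1 \<Longrightarrow> norm (\<phi> x) \<le> B" by (auto simp: bounded_pos)
  show thesis
  proof (rule that)
    show "norm (\<phi> x) \<le> B" for x
      using B \<phi> by (cases "norm x \<le> 1") (auto simp: smooth_on_unit_ball_def)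
  qed (use B in simp)
qed

lemma linear_bound_by_basis:
  fixes l :: "'a::euclidean_space \<Rightarrow> complex"
  assumes "linear l"
  shows "norm (l h) \<le> norm h * (\<Sum>e\<in>Basis. norm (l e))"
proof -
  have "l h = l (\<Sum>e\<in>Basis. (h \<bullet> e) *\<^sub>R e)" by (simp add: euclidean_representation)
  also have "\<dots> = (\<Sum>e\<in>Basis. (h \<bullet> e) *\<^sub>R l e)" by (simp add: linear_sum[OF assms] linear_cmul[OF assms])
  also have "norm \<dots> \<le> (\<Sum>e\<in>Basis. norm h * norm (l e))"
    by (rule sum_norm_le) (auto intro!: mult_right_mono Basis_le_norm)
  finally show ?thesis by (simp add: sum_distrib_left)
qed

lemma smooth_on_unit_ball_Lipschitz:
  fixes \<phi> :: "'a::euclidean_space \<Rightarrow> complex"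
  assumes \<phi>: "\<phi> \<in> smooth_on_unit_ball"
  obtains L where "0 \<le> L" "\<And>x y. norm (\<phi> y - \<phi> x) \<le> L * norm (y - x)"
proof -
  obtain D where D: "\<And>x. (\<phi> has_derivative D x) (at x)" and DS: "\<And>v. (\<lambda>x. D x v) \<in> smooth_on_unit_ball"
    using smooth_on_unit_ball_derivative[OF \<phi>] by blast
  have "\<exists>B\<ge>0. \<forall>x. norm (D x e) \<le> B" for e using smooth_on_unit_ball_bounded[OF DS[of e]] by metis
  then obtain B where B: "\<And>e. 0 \<le> B e" "\<And>e x. norm (D x e) \<le> B e" by metis
  have on: "onorm (D x) \<le> (\<Sum>e\<in>Basis. B e)" for x
  proof (rule onorm_bound)
    show "norm (D x h) \<le> (\<Sum>e\<in>Basis. B e) * norm h" for h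
    proof -
      have "norm (D x h) \<le> norm h * (\<Sum>e\<in>Basis. norm (D x e))"
        by (rule linear_bound_by_basis[OF has_derivative_linear[OF D]])
      also have "\<dots> \<le> norm h * (\<Sum>e\<in>Basis. B e)" by (intro mult_left_mono sum_mono B) auto
      finally show ?thesis by (simp add: mult.commute)
    qed
  qed (intro sum_nonneg B)
  show thesis
  proof (rule that)
    show "norm (\<phi> y - \<phi> x) \<le> (\<Sum>e\<in>Basis. B e) * norm (y - x)" for x y
      by (rule differentiable_bound[OF convex_UNIV, of \<phi> D]) (use D on in auto)
  qed (intro sum_nonneg B)
qed

text \<open>The remainder is quadratic with a constant that does not depend on the base point.  Such an estimate
passes to averages of translates without a limit argument.\<close>

lemma smooth_on_unit_ball_Taylor:
  fixes \<phi> :: "'a::euclidean_space \<Rightarrow> complex"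
  assumes \<phi>: "\<phi> \<in> smooth_on_unit_ball" and D: "\<And>x. (\<phi> has_derivative D x) (at x)"
    and DS: "\<And>v. (\<lambda>x. D x v) \<in> smooth_on_unit_ball"
  obtains M where "\<And>x y. norm (\<phi> y - \<phi> x - D x (y - x)) \<le> M * (norm (y - x))\<^sup>2"
proof -
  have "\<exists>L\<ge>0. \<forall>x y. norm (D y e - D x e) \<le> L * norm (y - x)" for e
    using smooth_on_unit_ball_Lipschitz[OF DS[of e]] by metis
  then obtain L where L: "\<And>e. 0 \<le> L e" "\<And>e x y. norm (D y e - D x e) \<le> L e * norm (y - x)" by metis
  define M where "M = (\<Sum>e\<in>Basis. L e)"
  have M: "0 \<le> M" unfolding M_def by (intro sum_nonneg L)
  have lip: "norm (D z h - D x h) \<le> norm h * (M * norm (z - x))" for x z h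
  proof -
    have "norm (D z h - D x h) \<le> norm h * (\<Sum>e\<in>Basis. norm (D z e - D x e))"
      by (rule linear_bound_by_basis[OF linear_compose_sub[OF has_derivative_linear[OF D] has_derivative_linear[OF D]]])
    also have "\<dots> \<le> norm h * (\<Sum>e\<in>Basis. L e * norm (z - x))"
      by (intro mult_left_mono sum_mono L) auto
    finally show ?thesis by (simp add: M_def sum_distrib_right)
  qed
  show thesis
  proof (rule that)
    fix x y
    have "norm (\<phi> y - \<phi> x - D x (y - x)) \<le> norm (y - x) * (M * norm (y - x))"
    proof (rule differentiable_bound_linearization[where S = "closed_segment x y"])
      show "x + t *\<^sub>R (y - x) \<in> closed_segment x y" if "t \<in> {0..1}" for t
        using that by (auto simp: closed_segment_def algebra_simps intro!: exI[of _ t])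
      show "(\<phi> has_derivative D z) (at z within closed_segment x y)" for z
        using D has_derivative_at_withinI by blast
      show "onorm (D z - D x) \<le> M * norm (y - x)" if "z \<in> closed_segment x y" for z
      proof (rule onorm_bound)
        have "norm (z - x) \<le> norm (y - x)" using segment_bound[OF that] by simp
        then show "norm ((D z - D x) h) \<le> M * norm (y - x) * norm h" for h
          using lip[of z h x] M mult_left_mono[of "norm (z - x)" "norm (y - x)" "norm h * M"]
          by (simp add: mult_ac)
      qed (use M in simp)
    qed simp
    then show "norm (\<phi> y - \<phi> x - D x (y - x)) \<le> M * (norm (y - x))\<^sup>2"
      by (simp add: power2_eq_square mult_ac)
  qed
qed

text \<open>Averaging a smooth function over a bounded random translation is convolution with the law of \<open>Y\<close>.
It keeps smoothness and compact support, and multiplies the Fourier transform by the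
characteristic function of \<open>Y\<close>.\<close>

locale random_translate = prob_space P for P :: "'w measure" +
  fixes Y :: "'w \<Rightarrow> 'a::euclidean_space" and R :: real
  assumes Y [measurable]: "Y \<in> borel_measurable P"
    and Y_bound: "\<And>\<omega>. norm (Y \<omega>) \<le> R"
begin

definition smear :: "('a \<Rightarrow> complex) \<Rightarrow> 'a \<Rightarrow> complex" where
  "smear \<phi> x = (\<integral>\<omega>. \<phi> (x - Y \<omega>) \<partial>P)"

lemma smear_integrable:
  assumes \<phi>: "\<phi> \<in> smooth_on_unit_ball"
  shows "integrable P (\<lambda>\<omega>. \<phi> (x - Y \<omega>))"
proof -
  obtain B where B: "\<And>x. norm (\<phi> x) \<le> B" using smooth_on_unit_ball_bounded[OF \<phi>] by blast
  have [measurable]: "\<phi> \<in> borel_measurable borel"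
    by (intro borel_measurable_continuous_onI smooth_on_unit_ball_continuous \<phi>)
  show ?thesis by (rule integrable_const_bound[of _ B]) (use B in auto)
qed

lemma smear_has_derivative:
  assumes \<phi>: "\<phi> \<in> smooth_on_unit_ball" and D: "\<And>x. (\<phi> has_derivative D x) (at x)"
    and DS: "\<And>v. (\<lambda>x. D x v) \<in> smooth_on_unit_ball"
  shows "(smear \<phi> has_derivative (\<lambda>v. smear (\<lambda>x. D x v) x)) (at x)"
proof -
  obtain M where M: "\<And>x y. norm (\<phi> y - \<phi> x - D x (y - x)) \<le> M * (norm (y - x))\<^sup>2"
    using smooth_on_unit_ball_Taylor[OF \<phi> D DS] by blast
  have linD: "linear (D z)" for z using D has_derivative_linear by blast
  have lin: "linear (\<lambda>v. smear (\<lambda>x. D x v) x)"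
    by (rule linearI)
      (simp_all add: smear_def linear_add[OF linD] linear_cmul[OF linD] smear_integrable[OF DS])
  show ?thesis
  proof (rule has_derivativeI_sandwich[of 1])
    show "bounded_linear (\<lambda>v. smear (\<lambda>x. D x v) x)"
      using lin by (simp add: linear_conv_bounded_linear)
    show "((\<lambda>y. M * norm (y - x)) \<longlongrightarrow> 0) (at x)"
      by (auto intro!: tendsto_eq_intros)
    fix y assume "y \<noteq> x"
    have "smear \<phi> y - smear \<phi> x - smear (\<lambda>z. D z (y - x)) x
        = (\<integral>\<omega>. \<phi> (y - Y \<omega>) - \<phi> (x - Y \<omega>) - D (x - Y \<omega>) (y - x) \<partial>P)"
      by (simp add: smear_def smear_integrable[OF \<phi>] smear_integrable[OF DS])
    also have "norm \<dots> \<le> M * (norm (y - x))\<^sup>2"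
    proof -
      have "norm (\<integral>\<omega>. \<phi> (y - Y \<omega>) - \<phi> (x - Y \<omega>) - D (x - Y \<omega>) (y - x) \<partial>P)
          \<le> (\<integral>\<omega>. M * (norm (y - x))\<^sup>2 \<partial>P)"
      proof (intro order_trans[OF integral_norm_bound] integral_mono integrable_norm)
        fix \<omega>
        show "norm (\<phi> (y - Y \<omega>) - \<phi> (x - Y \<omega>) - D (x - Y \<omega>) (y - x)) \<le> M * (norm (y - x))\<^sup>2"
          using M[of "y - Y \<omega>" "x - Y \<omega>"] by simp
      qed (auto intro!: smear_integrable[OF \<phi>] smear_integrable[OF DS])
      then show ?thesis by (simp add: prob_space)
    qed
    finally show "norm (smear \<phi> y - smear \<phi> x - smear (\<lambda>z. D z (y - x)) x) / norm (y - x) \<le> M * norm (y - x)"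
      using \<open>y \<noteq> x\<close> by (simp add: divide_le_eq power2_eq_square mult_ac)
  qed simp
qed

lemma C_diff_smear:
  assumes "\<phi> \<in> smooth_on_unit_ball"
  shows "C_diff k (smear \<phi>)"
proof (rule C_diff_coinduct[where S = "smear ` smooth_on_unit_ball"])
  fix \<psi> assume "\<psi> \<in> smear ` smooth_on_unit_ball"
  then obtain \<phi> where \<phi>: "\<psi> = smear \<phi>" "\<phi> \<in> smooth_on_unit_ball" by blast
  obtain D where "\<And>x. (\<phi> has_derivative D x) (at x)" "\<And>v. (\<lambda>x. D x v) \<in> smooth_on_unit_ball"
    using smooth_on_unit_ball_derivative[OF \<phi>(2)] by blast
  then show "\<exists>D. (\<forall>x. (\<psi> has_derivative D x) (at x)) \<and> (\<forall>v. (\<lambda>x. D x v) \<in> smear ` smooth_on_unit_ball)"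
    unfolding \<phi>(1)
    by (intro exI[of _ "\<lambda>x v. smear (\<lambda>x. D x v) x"]) (auto intro: smear_has_derivative[OF \<phi>(2)])
qed (use assms in simp)

lemma smear_support:
  assumes \<phi>: "\<phi> \<in> smooth_on_unit_ball" and "R + 1 < norm x"
  shows "smear \<phi> x = 0"
proof -
  have "\<phi> (x - Y \<omega>) = 0" for \<omega>
    using \<phi> norm_triangle_ineq2[of x "Y \<omega>"] Y_bound[of \<omega>] assms(2) by (simp add: smooth_on_unit_ball_def)
  then show ?thesis by (simp add: smear_def)
qed

lemma smear_Cc_infinity:
  assumes \<phi>: "\<phi> \<in> smooth_on_unit_ball"
  shows "smear \<phi> \<in> Cc_infinity"
proof -
  have "compactly_supported (smear \<phi>)"
    unfolding compactly_supported_iff using smear_support[OF \<phi>] by blast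
  then show ?thesis
    by (simp add: Cc_infinity_def C_diff_smear[OF \<phi>])
qed

lemma fourier_transform_smear:
  assumes \<phi>: "\<phi> \<in> smooth_on_unit_ball"
  shows "fourier_transform (smear \<phi>) y =
    (\<integral>\<omega>. exp (- (\<i> * complex_of_real (Y \<omega> \<bullet> y))) \<partial>P) * fourier_transform \<phi> y"
proof -
  define e where "e x = exp (- (\<i> * complex_of_real (x \<bullet> y)))" for x
  have cont\<phi>: "continuous_on UNIV \<phi>" by (rule smooth_on_unit_ball_continuous[OF \<phi>])
  have conte: "continuous_on UNIV e" unfolding e_def by (intro continuous_intros)
  have [measurable]: "\<phi> \<in> borel_measurable borel" "e \<in> borel_measurable borel"
    by (intro borel_measurable_continuous_onI cont\<phi> conte)+
  have norm_e: "norm (e x) = 1" for x by (simp add: e_def)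
  have e_add: "e (a + x) = e a * e x" for a x
    by (simp add: e_def inner_add_left distrib_left exp_add[symmetric])
  interpret pair_sigma_finite P "lborel :: 'a measure" ..
  have int\<phi>: "integrable lborel \<phi>"
  proof -
    have "\<phi> = (\<lambda>x. indicator (cball 0 1) x *\<^sub>R \<phi> x)"
      using \<phi> by (auto simp: fun_eq_iff indicator_def smooth_on_unit_ball_def)
    moreover have "integrable lborel (\<lambda>x. indicator (cball 0 1) x *\<^sub>R \<phi> x)"
      by (intro borel_integrable_compact compact_cball continuous_on_subset[OF cont\<phi>] subset_UNIV)
    ultimately show ?thesis by simp
  qed
  have int\<phi>e: "integrable lborel (\<lambda>x. \<phi> x * e x)"
    by (rule Bochner_Integration.integrable_bound[OF int\<phi>]) (auto simp: norm_mult norm_e)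
  have shift: "integral\<^sup>L lborel (\<lambda>x. g (x - a)) = integral\<^sup>L lborel g"
    if [measurable]: "g \<in> borel_measurable borel" for g :: "'a \<Rightarrow> 'b::{banach, second_countable_topology}" and a
  proof -
    have "integral\<^sup>L (distr lborel borel ((+) (- a))) g = integral\<^sup>L lborel (\<lambda>x. g (- a + x))"
      by (subst integral_distr) auto
    then show ?thesis unfolding lborel_distr_plus by simp
  qed
  have ishift: "integrable lborel (\<lambda>x. g (x - a))"
    if g: "integrable lborel g" for g :: "'a \<Rightarrow> complex" and a
  proof -
    have [measurable]: "g \<in> borel_measurable borel" using g by auto
    have "integrable (distr lborel borel ((+) (- a))) g \<longleftrightarrow> integrable lborel (\<lambda>x. g (- a + x))"
      by (subst integrable_distr_eq) auto
    then show ?thesis using g unfolding lborel_distr_plus by simp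
  qed
  define h where "h \<omega> x = \<phi> (x - Y \<omega>) * e x" for \<omega> x
  have [measurable]: "case_prod h \<in> borel_measurable (P \<Otimes>\<^sub>M lborel)" unfolding h_def by measurable
  have h_eq: "h \<omega> x = e (Y \<omega>) * (\<phi> (x - Y \<omega>) * e (x - Y \<omega>))" for \<omega> x
    using e_add[of "Y \<omega>" "x - Y \<omega>"] by (simp add: h_def)
  have h_int: "integrable lborel (h \<omega>)" for \<omega>
    unfolding h_eq by (intro integrable_mult_right ishift[of "\<lambda>x. \<phi> x * e x"] int\<phi>e)
  have pair: "integrable (P \<Otimes>\<^sub>M lborel) (case_prod h)"
  proof (rule Fubini_integrable)
    have "(\<integral>x. norm (h \<omega> x) \<partial>lborel) = (\<integral>x. norm (\<phi> x) \<partial>lborel)" for \<omega>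
      using shift[of "\<lambda>x. norm (\<phi> x)"] by (simp add: h_def norm_mult norm_e)
    then show "integrable P (\<lambda>\<omega>. \<integral>x. norm (case_prod h (\<omega>, x)) \<partial>lborel)" by simp
  qed (use h_int in auto)
  have smear_e: "smear \<phi> x * e x = (\<integral>\<omega>. h \<omega> x \<partial>P)" for x
    unfolding smear_def h_def by simp
  have "fourier_transform (smear \<phi>) y = (\<integral>x. smear \<phi> x * e x \<partial>lebesgue)"
    by (simp add: fourier_transform_def e_def)
  also have "\<dots> = (\<integral>x. smear \<phi> x * e x \<partial>lborel)"
    unfolding smear_e by (rule integral_completion) measurable
  also have "\<dots> = (\<integral>x. (\<integral>\<omega>. h \<omega> x \<partial>P) \<partial>lborel)" by (simp add: smear_e)
  also have "\<dots> = (\<integral>\<omega>. (\<integral>x. h \<omega> x \<partial>lborel) \<partial>P)"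
    by (rule Fubini_integral[OF pair])
  also have "\<dots> = (\<integral>\<omega>. e (Y \<omega>) * (\<integral>x. \<phi> x * e x \<partial>lborel) \<partial>P)"
    using shift[of "\<lambda>x. \<phi> x * e x"] by (simp add: h_eq)
  also have "\<dots> = (\<integral>\<omega>. e (Y \<omega>) \<partial>P) * (\<integral>x. \<phi> x * e x \<partial>lborel)" by simp
  also have "(\<integral>x. \<phi> x * e x \<partial>lborel) = fourier_transform \<phi> y"
    unfolding fourier_transform_def e_def[symmetric] by (rule integral_completion[symmetric]) measurable
  finally show ?thesis by (simp add: e_def)
qed

end

lemma bump_in_smooth_on_unit_ball: "(\<lambda>x. complex_of_real (bump x)) \<in> smooth_on_unit_ball"
  by (simp add: smooth_on_unit_ball_def C_diff_bump bump_eq_0)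

text \<open>At frequency zero the transform is the integral of a nonnegative continuous function that is
positive at the origin.\<close>

lemma fourier_transform_bump_0: "fourier_transform (\<lambda>x::'a::euclidean_space. complex_of_real (bump x)) 0 \<noteq> 0"
proof
  let ?\<psi> = "\<lambda>x::'a. complex_of_real (bump x)"
  let ?K = "cbox (- 1 *\<^sub>R One) (1 *\<^sub>R One) :: 'a set"
  assume "fourier_transform ?\<psi> 0 = 0"
  have cont: "continuous_on UNIV ?\<psi>" by (rule smooth_on_unit_ball_continuous[OF bump_in_smooth_on_unit_ball])
  have "continuous_on UNIV (\<lambda>x. Re (?\<psi> x))" by (intro continuous_intros cont)
  then have contb: "continuous_on ?K bump" using continuous_on_subset by (auto simp: o_def)
  have supp: "?\<psi> x = 0" if "x \<notin> ?K" for x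
    by (rule zero_outside_centred_cbox[OF _ that]) (simp add: bump_eq_0)
  have "complex_of_real (integral ?K bump) = integral ?K ?\<psi>"
    using integral_linear[OF integrable_continuous[OF contb], of complex_of_real] by (simp add: o_def bounded_linear_of_real)
  also have "\<dots> = fourier_transform ?\<psi> 0"
    using fourier_transform_cbox[OF cont, of "- 1 *\<^sub>R One" "1 *\<^sub>R One" 0] supp by simp
  finally have "integral ?K bump = 0" using \<open>fourier_transform ?\<psi> 0 = 0\<close> by simp
  then have "(bump has_integral 0) ?K"
    using integrable_integral[OF integrable_continuous[OF contb]] by simp
  then have "bump (0::'a) = 0"
    by (rule has_integral_0_cbox_imp_0[OF contb bump_nonneg]) (auto simp: box_ne_empty mem_box)
  then show False using bump_0_pos[where 'a = 'a] by simp
qed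

section \<open>The uniform distribution on the unit ball\<close>

text \<open>A translation by half a period changes the sign of the wave, so the integral over \<open>B\<close> only sees
the symmetric difference of \<open>B\<close> with its translate.\<close>

lemma fourier_half_period_shift:
  fixes y h :: "'a::euclidean_space"
  assumes hy: "h \<bullet> y = pi" and B: "B \<in> sets borel" "emeasure lborel B < \<infinity>"
  defines "e \<equiv> \<lambda>x. exp (- (\<i> * complex_of_real (x \<bullet> y)))"
  shows "2 * (\<integral>x. indicator B x *\<^sub>R e x \<partial>lborel) = (\<integral>x. (indicator B x - indicator B (x - h)) *\<^sub>R e x \<partial>lborel)"
proof -
  have [measurable]: "e \<in> borel_measurable borel"
    unfolding e_def by (intro borel_measurable_continuous_onI continuous_intros)
  have [measurable]: "B \<in> sets borel" by (rule B)
  have e_shift: "e (x + h) = - e x" for x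
    by (simp add: e_def inner_add_left hy distrib_left exp_add exp_minus)
  have e_back: "e (x - h) = - e x" for x
    using arg_cong[OF e_shift[of "x - h"], of uminus] by (simp only: minus_minus diff_add_cancel)
  have "(\<integral>x. indicator B (x - h) *\<^sub>R e x \<partial>distr lborel borel ((+) h)) = (\<integral>x. indicator B (h + x - h) *\<^sub>R e (h + x) \<partial>lborel)"
    by (subst integral_distr) auto
  also have "\<dots> = (\<integral>x. - (indicator B x *\<^sub>R e x) \<partial>lborel)"
    by (intro Bochner_Integration.integral_cong) (auto simp: e_shift add.commute)
  finally have eq: "(\<integral>x. indicator B (x - h) *\<^sub>R e x \<partial>lborel) = - (\<integral>x. indicator B x *\<^sub>R e x \<partial>lborel)"
    unfolding lborel_distr_plus by simp
  have int: "integrable lborel (\<lambda>x. indicator B x *\<^sub>R e x)"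
    by (rule Bochner_Integration.integrable_bound[of _ "indicator B :: _ \<Rightarrow> real"])
      (use B in \<open>auto simp: e_def indicator_def\<close>)
  have int': "integrable lborel (\<lambda>x. indicator B (x - h) *\<^sub>R e x)"
  proof -
    have "integrable (distr lborel borel ((+) (- h))) (\<lambda>x. indicator B x *\<^sub>R e x) \<longleftrightarrow>
        integrable lborel (\<lambda>x. indicator B (- h + x) *\<^sub>R e (- h + x))"
      by (subst integrable_distr_eq) auto
    moreover have "(\<lambda>x. indicator B (- h + x) *\<^sub>R e (- h + x)) = (\<lambda>x. - (indicator B (x - h) *\<^sub>R e x))"
      by (simp add: fun_eq_iff e_back)
    ultimately show ?thesis using int unfolding lborel_distr_plus by simp
  qed
  show ?thesis using int int' by (simp add: scaleR_diff_left eq)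
qed

lemma symmetric_difference_shifted_ball:
  fixes h :: "'a::euclidean_space"
  assumes "norm h \<le> d" "d \<le> 1"
  shows "(\<integral>x. \<bar>indicator (cball 0 1) x - indicator (cball 0 1) (x - h)\<bar> \<partial>(lborel :: 'a measure))
    \<le> unit_ball_vol (real DIM('a)) * ((1 + d) ^ DIM('a) - (1 - d) ^ DIM('a))"
proof -
  have d: "0 \<le> d" using assms norm_ge_zero order_trans by blast
  let ?J = "\<lambda>x::'a. indicator (cball 0 (1 + d)) x - indicator (cball 0 (1 - d)) x :: real"
  have fin: "emeasure lborel (cball (0::'a) r) < \<infinity>" for r
    by (rule emeasure_lborel_cball_finite)
  have intJ: "integrable lborel ?J"
    using fin by (intro Bochner_Integration.integrable_diff) (auto simp: less_top[symmetric])
  have le: "\<bar>indicator (cball 0 1) x - indicator (cball 0 1) (x - h)\<bar> \<le> ?J x" for x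
  proof -
    have "norm (x - h) \<le> norm x + norm h" "norm x \<le> norm (x - h) + norm h"
      using norm_triangle_ineq4[of x h] norm_triangle_ineq[of "x - h" h] by auto
    then show ?thesis using assms by (auto simp: indicator_def)
  qed
  have "(\<integral>x. \<bar>indicator (cball 0 1) x - indicator (cball 0 1) (x - h)\<bar> \<partial>(lborel :: 'a measure)) \<le> (\<integral>x. ?J x \<partial>lborel)"
    by (rule integral_mono') (use intJ le order_trans[OF abs_ge_zero le] in auto)
  also have "\<dots> = measure lborel (cball (0::'a) (1 + d)) - measure lborel (cball (0::'a) (1 - d))"
    using fin by (subst Bochner_Integration.integral_diff) (auto simp: less_top[symmetric])
  also have "\<dots> = unit_ball_vol (real DIM('a)) * ((1 + d) ^ DIM('a) - (1 - d) ^ DIM('a))"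
    using d assms by (simp add: content_cball algebra_simps)
  finally show ?thesis .
qed

definition ball_law :: "'a::euclidean_space measure" where
  "ball_law = uniform_measure lborel (cball 0 1)"

lemma sets_ball_law [measurable_cong, simp]: "sets ball_law = sets borel"
  by (simp add: ball_law_def)

lemma space_ball_law [simp]: "space ball_law = UNIV"
  by (simp add: ball_law_def)

lemma emeasure_unit_cball:
  "emeasure lborel (cball (0::'a::euclidean_space) 1) = ennreal (unit_ball_vol (real DIM('a)))"
  by (simp add: emeasure_cball)

lemma prob_space_ball_law: "prob_space (ball_law :: 'a::euclidean_space measure)"
  unfolding ball_law_def
  by (rule prob_space_uniform_measure)
    (auto simp: emeasure_unit_cball unit_ball_vol_pos less_imp_neq[symmetric] ennreal_eq_0_iff not_le)

text \<open>The characteristic function of the uniform distribution on the unit ball, at \<open>- y\<close>.\<close>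

definition ball_char :: "'a::euclidean_space \<Rightarrow> complex" where
  "ball_char y = (\<integral>u. indicator (cball 0 1) u *\<^sub>R exp (- (\<i> * complex_of_real (u \<bullet> y))) \<partial>lborel)
     / unit_ball_vol (real DIM('a))"

lemma integral_ball_law:
  fixes f :: "'a::euclidean_space \<Rightarrow> complex"
  assumes [measurable]: "f \<in> borel_measurable borel"
  shows "(\<integral>u. f u \<partial>ball_law) = (\<integral>u. indicator (cball 0 1) u *\<^sub>R f u \<partial>lborel) / unit_ball_vol (real DIM('a))"
proof -
  have dens: "(ball_law :: 'a measure) = density lborel (\<lambda>u. ennreal (indicator (cball 0 1) u / unit_ball_vol (real DIM('a))))"
    unfolding ball_law_def uniform_measure_def emeasure_unit_cball
    by (intro density_cong) (auto simp: indicator_def divide_ennreal unit_ball_vol_pos simp flip: ennreal_1)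
  have "(\<integral>u. f u \<partial>ball_law) = (\<integral>u. (indicator (cball 0 1) u / unit_ball_vol (real DIM('a))) *\<^sub>R f u \<partial>lborel)"
  proof -
    have [measurable]: "cball (0::'a) 1 \<in> sets borel" by simp
    have "(\<lambda>u::'a. indicat_real (cball 0 1) u / unit_ball_vol (real DIM('a))) \<in> borel_measurable lborel"
      by measurable
    then show ?thesis unfolding dens by (subst integral_density) (auto simp: unit_ball_vol_nonneg)
  qed
  also have "\<dots> = (\<integral>u. (indicator (cball 0 1) u *\<^sub>R f u) / unit_ball_vol (real DIM('a)) \<partial>lborel)"
    by (intro Bochner_Integration.integral_cong) (auto simp: scaleR_conv_of_real)
  finally show ?thesis by simp
qed

text \<open>For large frequencies the half period \<open>\<pi> / norm y\<close> is small, and then so is the volume in which the unit ball and its translate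
differ.\<close>

lemma ball_char_decay:
  assumes "0 < \<epsilon>"
  obtains A where "0 < A" "\<And>y::'a::euclidean_space. A \<le> norm y \<Longrightarrow> norm (ball_char y) \<le> \<epsilon>"
proof -
  define c where "c = unit_ball_vol (real DIM('a))"
  have c: "0 < c" unfolding c_def by (rule unit_ball_vol_pos) simp
  have "((\<lambda>d. (1 + d) ^ DIM('a) - (1 - d) ^ DIM('a)) \<longlongrightarrow> (1 + 0) ^ DIM('a) - (1 - 0) ^ DIM('a)) (at_right (0::real))"
    by (intro tendsto_intros)
  then have "\<forall>\<^sub>F d in at_right 0. (1 + d) ^ DIM('a) - (1 - d) ^ DIM('a) < 2 * \<epsilon>"
    using assms by (intro order_tendstoD) auto
  then obtain b where b: "0 < b" "\<And>d. 0 < d \<Longrightarrow> d < b \<Longrightarrow> (1 + d) ^ DIM('a) - (1 - d) ^ DIM('a) < 2 * \<epsilon>"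
    unfolding eventually_at_right_field by auto
  define d where "d = min (b / 2) 1"
  have d: "0 < d" "d \<le> 1" "(1 + d) ^ DIM('a) - (1 - d) ^ DIM('a) < 2 * \<epsilon>"
    using b by (auto simp: d_def)
  show thesis
  proof (rule that)
    show "0 < pi / d" using d by simp
    fix y :: 'a assume y: "pi / d \<le> norm y"
    have y0: "0 < norm y" using y \<open>0 < pi / d\<close> by linarith
    define h where "h = (pi / (norm y)\<^sup>2) *\<^sub>R y"
    have hy: "h \<bullet> y = pi" using y0 by (simp add: h_def dot_square_norm)
    have nh: "norm h \<le> d"
      using y0 y d by (simp add: h_def power2_eq_square field_simps)
    let ?e = "\<lambda>u. exp (- (\<i> * complex_of_real (u \<bullet> y)))"
    let ?I = "\<integral>u. indicator (cball 0 1) u *\<^sub>R ?e u \<partial>lborel"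
    have "2 * norm ?I = norm (2 * ?I)" by (simp add: norm_mult)
    also have "2 * ?I = (\<integral>u. (indicator (cball 0 1) u - indicator (cball 0 1) (u - h)) *\<^sub>R ?e u \<partial>lborel)"
      by (rule fourier_half_period_shift[OF hy]) (simp_all add: emeasure_unit_cball)
    also have "norm \<dots> \<le> (\<integral>u. \<bar>indicator (cball 0 1) u - indicator (cball 0 1) (u - h)\<bar> \<partial>(lborel :: 'a measure))"
      by (rule order_trans[OF integral_norm_bound]) simp
    also have "\<dots> \<le> c * ((1 + d) ^ DIM('a) - (1 - d) ^ DIM('a))"
      unfolding c_def by (rule symmetric_difference_shifted_ball[OF nh d(2)])
    also have "\<dots> \<le> c * (2 * \<epsilon>)" using d c by (intro mult_left_mono) auto
    finally have "norm ?I \<le> c * \<epsilon>" by simp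
    then show "norm (ball_char y) \<le> \<epsilon>"
      unfolding ball_char_def c_def[symmetric] using c by (simp add: norm_divide divide_le_eq mult.commute)
  qed
qed

lemma norm_ball_char_le_1: "norm (ball_char y) \<le> 1"
proof -
  interpret prob_space "ball_law :: 'a measure" by (rule prob_space_ball_law)
  have "ball_char y = (\<integral>u. exp (- (\<i> * complex_of_real (u \<bullet> y))) \<partial>ball_law)"
    unfolding ball_char_def by (rule integral_ball_law[symmetric]) (intro borel_measurable_continuous_onI continuous_intros)
  also have "norm \<dots> \<le> (\<integral>u. norm (exp (- (\<i> * complex_of_real (u \<bullet> y)))) \<partial>ball_law)"
    by (rule integral_norm_bound)
  finally show ?thesis using prob_space by simp
qed

lemma ball_char_orthogonal:
  fixes Q :: "'a::euclidean_space \<Rightarrow> 'a"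
  assumes Q: "orthogonal_transformation Q"
  shows "ball_char (Q y) = ball_char y"
proof -
  let ?f = "\<lambda>u. indicator (cball 0 1) u *\<^sub>R exp (- (\<i> * complex_of_real (u \<bullet> Q y)))"
  have [measurable]: "(\<lambda>u. exp (- (\<i> * complex_of_real (u \<bullet> Q y)))) \<in> borel_measurable borel"
    by (intro borel_measurable_continuous_onI continuous_intros)
  have [measurable]: "cball (0::'a) 1 \<in> sets borel" by simp
  have "(\<integral>u. ?f (Q u) \<partial>lborel) = (\<integral>u. ?f u \<partial>lborel)"
    by (rule integral_orthogonal_transformation[OF Q]) measurable
  then show ?thesis
    using Q by (simp add: ball_char_def orthogonal_transformation indicator_def)
      (simp add: Q[unfolded orthogonal_transformation_def])
qed

section \<open>Dyadic random series\<close>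

text \<open>A point drawn from \<open>ball_law\<close> lies in the unit ball only almost surely.  Clipping makes every
sample path of the random series below bounded, at no cost to its law.\<close>

definition clip :: "'a::euclidean_space \<Rightarrow> 'a" where
  "clip u = (if norm u \<le> 1 then u else 0)"

lemma norm_clip: "norm (clip u) \<le> 1"
  by (simp add: clip_def)

lemma measurable_clip [measurable]: "clip \<in> borel_measurable borel"
  unfolding clip_def by measurable

definition ball_laws :: "(nat \<times> nat \<Rightarrow> 'a::euclidean_space) measure" where
  "ball_laws = PiM UNIV (\<lambda>_. ball_law)"

text \<open>Independent uniform points of the unit ball are indexed by pairs: \<open>m j\<close> of them enter with weight \<open>a / 2 ^ j\<close>.
The group of index \<open>j\<close> is responsible for the decay of the characteristic function at
frequencies of size about \<open>2 ^ j\<close>.\<close>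

definition dyadic_term :: "real \<Rightarrow> (nat \<Rightarrow> nat) \<Rightarrow> nat \<Rightarrow> (nat \<times> nat \<Rightarrow> 'a::euclidean_space) \<Rightarrow> 'a" where
  "dyadic_term a m j \<omega> = (a / 2 ^ j) *\<^sub>R (\<Sum>i<m j. clip (\<omega> (j, i)))"

definition dyadic_sum :: "real \<Rightarrow> (nat \<Rightarrow> nat) \<Rightarrow> (nat \<times> nat \<Rightarrow> 'a::euclidean_space) \<Rightarrow> 'a" where
  "dyadic_sum a m \<omega> = (\<Sum>j. dyadic_term a m j \<omega>)"

lemma measurable_dyadic_term [measurable]: "dyadic_term a m j \<in> borel_measurable ball_laws"
  unfolding dyadic_term_def ball_laws_def by measurable

lemma measurable_dyadic_sum [measurable]: "dyadic_sum a m \<in> borel_measurable ball_laws"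
  unfolding dyadic_sum_def by measurable

lemma norm_dyadic_term: "0 \<le> a \<Longrightarrow> norm (dyadic_term a m j \<omega>) \<le> a * (real (m j) / 2 ^ j)"
proof -
  assume a: "0 \<le> a"
  have "norm (\<Sum>i<m j. clip (\<omega> (j, i))) \<le> (\<Sum>i<m j. 1)"
    by (rule sum_norm_le) (rule norm_clip)
  then have "(a / 2 ^ j) * norm (\<Sum>i<m j. clip (\<omega> (j, i))) \<le> (a / 2 ^ j) * real (m j)"
    using a by (intro mult_left_mono) auto
  then show ?thesis using a by (simp add: dyadic_term_def)
qed

lemma prob_space_ball_laws: "prob_space ball_laws"
  unfolding ball_laws_def by (intro prob_space_PiM prob_space_ball_law)

lemma random_translate_dyadic_sum:
  assumes a: "0 \<le> a" and sm: "summable (\<lambda>j. real (m j) / 2 ^ j)"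
  shows "random_translate ball_laws (dyadic_sum a m) (\<Sum>j. a * (real (m j) / 2 ^ j))"
proof -
  interpret prob_space ball_laws by (rule prob_space_ball_laws)
  show ?thesis
  proof
    show "norm (dyadic_sum a m \<omega>) \<le> (\<Sum>j. a * (real (m j) / 2 ^ j))" for \<omega>
      unfolding dyadic_sum_def by (intro norm_suminf_le norm_dyadic_term a summable_mult sm)
  qed measurable
qed

lemma integral_wave_clip_ball_law:
  fixes y :: "'a::euclidean_space"
  shows "(\<integral>u. exp (- (\<i> * complex_of_real (clip u \<bullet> y))) \<partial>ball_law) = ball_char y"
proof -
  have "(\<integral>u. exp (- (\<i> * complex_of_real (clip u \<bullet> y))) \<partial>ball_law)
      = (\<integral>u. indicator (cball 0 1) u *\<^sub>R exp (- (\<i> * complex_of_real (clip u \<bullet> y))) \<partial>lborel) / unit_ball_vol (real DIM('a))"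
    by (rule integral_ball_law) measurable
  also have "(\<lambda>u. indicator (cball 0 1) u *\<^sub>R exp (- (\<i> * complex_of_real (clip u \<bullet> y))))
      = (\<lambda>u. indicator (cball 0 1) u *\<^sub>R exp (- (\<i> * complex_of_real (u \<bullet> y))))"
    by (auto simp: fun_eq_iff indicator_def clip_def)
  finally show ?thesis by (simp add: ball_char_def)
qed

lemma partial_sum_characteristic:
  fixes y :: "'a::euclidean_space"
  shows "(\<integral>\<omega>. exp (- (\<i> * complex_of_real ((\<Sum>j<N. dyadic_term a m j \<omega>) \<bullet> y))) \<partial>ball_laws)
    = (\<Prod>j<N. ball_char ((a / 2 ^ j) *\<^sub>R y) ^ m j)"
proof -
  interpret B: prob_space "ball_law :: 'a measure" by (rule prob_space_ball_law)
  interpret PP: product_prob_space "\<lambda>_ :: nat \<times> nat. ball_law :: 'a measure" UNIV ..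
  define J where "J = Sigma {..<N} (\<lambda>j. {..<m j})"
  have J: "finite J" by (simp add: J_def)
  define f where "f k u = exp (- (\<i> * complex_of_real (clip u \<bullet> ((a / 2 ^ fst k) *\<^sub>R y))))" for k :: "nat \<times> nat" and u :: 'a
  have [measurable]: "f k \<in> borel_measurable borel" for k unfolding f_def by measurable
  have eq: "exp (- (\<i> * complex_of_real ((\<Sum>j<N. dyadic_term a m j \<omega>) \<bullet> y))) = (\<Prod>k\<in>J. f k (restrict \<omega> J k))" for \<omega>
  proof -
    have "(\<Sum>j<N. dyadic_term a m j \<omega>) \<bullet> y = (\<Sum>j<N. \<Sum>i<m j. clip (\<omega> (j, i)) \<bullet> ((a / 2 ^ j) *\<^sub>R y))"
      by (simp add: dyadic_term_def inner_sum_left sum_distrib_left)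
    also have "\<dots> = (\<Sum>k\<in>J. clip (\<omega> k) \<bullet> ((a / 2 ^ fst k) *\<^sub>R y))"
      unfolding J_def by (subst sum.Sigma) (auto simp: case_prod_beta)
    finally show ?thesis
      by (simp add: f_def sum_distrib_left exp_sum[OF J] flip: sum_negf)
  qed
  have "(\<integral>\<omega>. exp (- (\<i> * complex_of_real ((\<Sum>j<N. dyadic_term a m j \<omega>) \<bullet> y))) \<partial>ball_laws)
      = (\<integral>\<omega>. (\<Prod>k\<in>J. f k (restrict \<omega> J k)) \<partial>PiM UNIV (\<lambda>_. ball_law))"
    unfolding eq ball_laws_def ..
  also have "\<dots> = (\<integral>x. (\<Prod>k\<in>J. f k (x k)) \<partial>distr (PiM UNIV (\<lambda>_. ball_law)) (PiM J (\<lambda>_. ball_law)) (\<lambda>\<omega>. restrict \<omega> J))"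
    by (subst integral_distr) (auto intro!: measurable_restrict_subset)
  also have "\<dots> = (\<integral>x. (\<Prod>k\<in>J. f k (x k)) \<partial>PiM J (\<lambda>_. ball_law))"
    by (simp add: PP.distr_PiM_restrict_finite[OF J])
  also have "\<dots> = (\<Prod>k\<in>J. \<integral>u. f k u \<partial>ball_law)"
  proof (rule PP.product_integral_prod[OF J])
    show "integrable ball_law (f k)" for k
      by (rule B.integrable_const_bound[of _ 1]) (auto simp: f_def)
  qed
  also have "\<dots> = (\<Prod>k\<in>J. ball_char ((a / 2 ^ fst k) *\<^sub>R y))"
    unfolding f_def by (simp only: integral_wave_clip_ball_law)
  also have "\<dots> = (\<Prod>j<N. \<Prod>i<m j. ball_char ((a / 2 ^ j) *\<^sub>R y))"
    unfolding J_def by (subst prod.Sigma) (auto simp: case_prod_beta)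
  finally show ?thesis by simp
qed

text \<open>The factor by which \<open>random_translate.smear\<close> multiplies the Fourier transform when the translation is
\<open>dyadic_sum a m\<close>.\<close>

definition dyadic_char :: "real \<Rightarrow> (nat \<Rightarrow> nat) \<Rightarrow> 'a::euclidean_space \<Rightarrow> complex" where
  "dyadic_char a m y = (\<integral>\<omega>. exp (- (\<i> * complex_of_real (dyadic_sum a m \<omega> \<bullet> y))) \<partial>ball_laws)"

lemma dyadic_char_product:
  fixes y :: "'a::euclidean_space"
  assumes a: "0 \<le> a" and sm: "summable (\<lambda>j. real (m j) / 2 ^ j)"
  shows "(\<lambda>N. \<Prod>j<N. ball_char ((a / 2 ^ j) *\<^sub>R y) ^ m j) \<longlonglongrightarrow> dyadic_char a m y"
proof -
  interpret prob_space "ball_laws :: (nat \<times> nat \<Rightarrow> 'a) measure" by (rule prob_space_ball_laws)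
  have "(\<lambda>N. \<integral>\<omega>. exp (- (\<i> * complex_of_real ((\<Sum>j<N. dyadic_term a m j \<omega>) \<bullet> y))) \<partial>ball_laws) \<longlonglongrightarrow> dyadic_char a m y"
    unfolding dyadic_char_def
  proof (rule integral_dominated_convergence[where w = "\<lambda>_. 1"])
    show "AE \<omega> in ball_laws. (\<lambda>N. exp (- (\<i> * complex_of_real ((\<Sum>j<N. dyadic_term a m j \<omega>) \<bullet> y))))
        \<longlonglongrightarrow> exp (- (\<i> * complex_of_real (dyadic_sum a m \<omega> \<bullet> y)))"
    proof (rule AE_I2)
      fix \<omega> :: "nat \<times> nat \<Rightarrow> 'a"
      have "summable (\<lambda>j. dyadic_term a m j \<omega>)"
        by (rule summable_comparison_test'[OF summable_mult[OF sm]]) (rule norm_dyadic_term[OF a])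
      then have "(\<lambda>N. \<Sum>j<N. dyadic_term a m j \<omega>) \<longlonglongrightarrow> dyadic_sum a m \<omega>"
        unfolding dyadic_sum_def by (rule summable_LIMSEQ)
      then show "(\<lambda>N. exp (- (\<i> * complex_of_real ((\<Sum>j<N. dyadic_term a m j \<omega>) \<bullet> y))))
        \<longlonglongrightarrow> exp (- (\<i> * complex_of_real (dyadic_sum a m \<omega> \<bullet> y)))"
        by (intro tendsto_intros)
    qed
  qed auto
  then show ?thesis by (simp add: partial_sum_characteristic)
qed

text \<open>All factors of the infinite product have modulus at most one, so any single group of equal factors
bounds the product.\<close>

lemma dyadic_char_bound:
  fixes y :: "'a::euclidean_space"
  assumes a: "0 \<le> a" and sm: "summable (\<lambda>j. real (m j) / 2 ^ j)"
    and small: "norm (ball_char ((a / 2 ^ j) *\<^sub>R y)) \<le> \<epsilon>"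
  shows "norm (dyadic_char a m y) \<le> \<epsilon> ^ m j"
proof (rule LIMSEQ_le_const2)
  let ?c = "\<lambda>j. norm (ball_char ((a / 2 ^ j) *\<^sub>R y)) ^ m j"
  show "(\<lambda>N. norm (\<Prod>j<N. ball_char ((a / 2 ^ j) *\<^sub>R y) ^ m j)) \<longlonglongrightarrow> norm (dyadic_char a m y)"
    by (intro tendsto_norm dyadic_char_product a sm)
  show "\<exists>N. \<forall>n\<ge>N. norm (\<Prod>j<n. ball_char ((a / 2 ^ j) *\<^sub>R y) ^ m j) \<le> \<epsilon> ^ m j"
  proof (intro exI allI impI)
    fix n assume "Suc j \<le> n"
    have "norm (\<Prod>j<n. ball_char ((a / 2 ^ j) *\<^sub>R y) ^ m j) = (\<Prod>j<n. ?c j)"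
      by (simp add: prod_norm norm_power flip: prod_norm)
    also have "\<dots> = ?c j * (\<Prod>j\<in>{..<n} - {j}. ?c j)"
      using \<open>Suc j \<le> n\<close> by (intro prod.remove) auto
    also have "\<dots> \<le> ?c j * 1"
      by (intro mult_left_mono prod_le_1) (auto intro!: power_le_one norm_ball_char_le_1)
    also have "\<dots> \<le> \<epsilon> ^ m j" using small by (simp add: power_mono)
    finally show "norm (\<Prod>j<n. ball_char ((a / 2 ^ j) *\<^sub>R y) ^ m j) \<le> \<epsilon> ^ m j" .
  qed
qed

lemma norm_dyadic_char_le_1: "norm (dyadic_char a m (y :: 'a::euclidean_space)) \<le> 1"
proof -
  interpret prob_space "ball_laws :: (nat \<times> nat \<Rightarrow> 'a) measure" by (rule prob_space_ball_laws)
  have "norm (dyadic_char a m y) \<le> (\<integral>\<omega>. norm (exp (- (\<i> * complex_of_real (dyadic_sum a m \<omega> \<bullet> y)))) \<partial>ball_laws)"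
    unfolding dyadic_char_def by (rule integral_norm_bound)
  then show ?thesis using prob_space by simp
qed

lemma dyadic_char_0: "dyadic_char a m (0 :: 'a::euclidean_space) = 1"
proof -
  interpret prob_space "ball_laws :: (nat \<times> nat \<Rightarrow> 'a) measure" by (rule prob_space_ball_laws)
  show ?thesis using prob_space by (simp add: dyadic_char_def)
qed

lemma dyadic_char_orthogonal:
  fixes Q :: "'a::euclidean_space \<Rightarrow> 'a"
  assumes "0 \<le> a" and "summable (\<lambda>j. real (m j) / 2 ^ j)" and Q: "orthogonal_transformation Q"
  shows "dyadic_char a m (Q y) = dyadic_char a m y"
proof (rule LIMSEQ_unique)
  show "(\<lambda>N. \<Prod>j<N. ball_char ((a / 2 ^ j) *\<^sub>R Q y) ^ m j) \<longlonglongrightarrow> dyadic_char a m (Q y)"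
    by (intro dyadic_char_product assms)
  have "ball_char ((a / 2 ^ j) *\<^sub>R Q y) = ball_char ((a / 2 ^ j) *\<^sub>R y)" for j
    using ball_char_orthogonal[OF Q, of "(a / 2 ^ j) *\<^sub>R y"] orthogonal_transformation_scaleR[OF Q] by simp
  then show "(\<lambda>N. \<Prod>j<N. ball_char ((a / 2 ^ j) *\<^sub>R Q y) ^ m j) \<longlonglongrightarrow> dyadic_char a m y"
    using dyadic_char_product[OF assms(1,2), of y] by simp
qed

section \<open>Existence when the tail converges\<close>

text \<open>On the shell of radii between \<open>2 ^ (j + 1)\<close> and \<open>2 ^ (j + 2)\<close> the profile is at least \<open>g (2 ^ (j + 1))\<close> by monotonicity.  The
volume of the shell is at least a multiple of \<open>2 ^ ((j + 2) * n)\<close>, so the shell contributes at least a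
multiple of \<open>g (2 ^ (j + 1)) / 2 ^ j\<close> to the tail integral.\<close>

lemma summable_of_tail_integral_finite:
  fixes \<theta> :: "real ^ 'n \<Rightarrow> real"
  assumes nn: "\<And>r. 0 \<le> r \<Longrightarrow> 0 \<le> g r" and mono: "mono_on {0..} g" and \<theta>: "\<And>y. \<theta> y = g (norm y)"
    and fin: "tail_integral \<theta> < \<infinity>"
  shows "summable (\<lambda>j. g (2 ^ (j + 1)) / 2 ^ j)"
proof -
  define n where "n = CARD('n)"
  have n: "1 \<le> n" by (simp add: n_def Suc_leI)
  define c where "c = unit_ball_vol (real n)"
  have c: "0 < c" unfolding c_def by (rule unit_ball_vol_pos) simp
  define D :: "nat \<Rightarrow> (real ^ 'n) set" where "D j = ball 0 (2 ^ (j + 2)) - ball 0 (2 ^ (j + 1))" for j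
  have D_iff: "y \<in> D j \<longleftrightarrow> 2 ^ (j + 1) \<le> norm y \<and> norm y < 2 ^ (j + 2)" for y j
    by (auto simp: D_def)
  have D_meas: "D j \<in> sets lebesgue" for j by (auto simp: D_def)
  have D_vol: "ennreal (c * 2 ^ ((j + 2) * n) / 2) \<le> emeasure lebesgue (D j)" for j
  proof -
    have "emeasure lebesgue (D j) = emeasure lborel (ball (0::real^'n) (2 ^ (j + 2))) - emeasure lborel (ball (0::real^'n) (2 ^ (j + 1)))"
    proof -
      have "ball (0::real^'n) (2 ^ (j + 1)) \<subseteq> ball 0 (2 ^ (j + 2))" by (intro subset_ball) simp
      moreover have "D j \<in> sets lborel" by (auto simp: D_def)
      ultimately show ?thesis
        unfolding D_def using emeasure_lborel_ball_finite[of "0::real^'n"]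
        by (subst emeasure_Diff[symmetric]) (auto simp: less_top[symmetric])
    qed
    also have "\<dots> = ennreal (c * (2 ^ (j + 2)) ^ n - c * (2 ^ (j + 1)) ^ n)"
      using c by (simp add: emeasure_ball c_def n_def ennreal_minus)
    finally have vol: "emeasure lebesgue (D j) = ennreal (c * (2 ^ (j + 2)) ^ n - c * (2 ^ (j + 1)) ^ n)" .
    have "c * 2 ^ ((j + 2) * n) / 2 \<le> c * (2 ^ (j + 2)) ^ n - c * (2 ^ (j + 1)) ^ n"
    proof -
      have "2 * (2 ^ (j + 1)) ^ n \<le> (2::real) ^ n * (2 ^ (j + 1)) ^ n"
        using power_increasing[OF n, of "2::real"] by (intro mult_right_mono) auto
      also have "\<dots> = (2 ^ (j + 2)) ^ n" by (simp only: power_mult_distrib[symmetric]) simp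
      finally have "c * (2 * (2 ^ (j + 1)) ^ n) \<le> c * (2 ^ (j + 2)) ^ n"
        using c by (intro mult_left_mono) auto
      then show ?thesis by (simp only: power_mult)
    qed
    then show ?thesis unfolding vol by (rule ennreal_leI)
  qed
  define K where "K j = g (2 ^ (j + 1)) / 2 ^ ((j + 2) * (n + 1))" for j
  have K: "0 \<le> K j" for j using nn by (simp add: K_def)
  have K_le: "K j \<le> \<theta> y / norm y ^ (n + 1)" if "y \<in> D j" for y j
  proof -
    have y: "2 ^ (j + 1) \<le> norm y" "norm y \<le> 2 ^ (j + 2)" using that by (auto simp: D_iff)
    have "0 < norm y" using y(1) less_le_trans[of 0 "2 ^ (j + 1)" "norm y"] by simp
    have "g (2 ^ (j + 1)) \<le> \<theta> y" unfolding \<theta> by (rule mono_onD[OF mono]) (use y in auto)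
    moreover have "norm y ^ (n + 1) \<le> 2 ^ ((j + 2) * (n + 1))"
      unfolding power_mult by (rule power_mono) (use y in auto)
    moreover have "0 \<le> \<theta> y" unfolding \<theta> by (rule nn) simp
    moreover have "0 < norm y ^ (n + 1)" using \<open>0 < norm y\<close> by (rule zero_less_power)
    ultimately show ?thesis
      unfolding K_def by (intro frac_le)
  qed
  have uniq: "i = j" if "y \<in> D i" "y \<in> D j" for y i j
  proof -
    have "(2::real) ^ (i + 1) < 2 ^ (j + 2)" "(2::real) ^ (j + 1) < 2 ^ (i + 2)"
      using that by (auto simp: D_iff)
    then have "i + 1 < j + 2" "j + 1 < i + 2" by (simp_all only: power_strict_increasing_iff one_less_numeral_iff semiring_norm)
    then show ?thesis by simp
  qed
  have partial: "ennreal (\<Sum>j<N. c / 8 * (g (2 ^ (j + 1)) / 2 ^ j)) \<le> tail_integral \<theta>" for N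
  proof -
    have "ennreal (\<Sum>j<N. c / 8 * (g (2 ^ (j + 1)) / 2 ^ j)) = (\<Sum>j<N. ennreal (c / 8 * (g (2 ^ (j + 1)) / 2 ^ j)))"
      using c nn by (intro sum_ennreal[symmetric]) auto
    also have "\<dots> = (\<Sum>j<N. ennreal (K j) * ennreal (c * 2 ^ ((j + 2) * n) / 2))"
    proof (rule sum.cong[OF refl])
      fix j
      have "(2::real) ^ ((j + 2) * (n + 1)) = 2 ^ ((j + 2) * n) * (2 ^ j * 4)"
        by (simp add: power_add algebra_simps)
      then have "K j * (c * 2 ^ ((j + 2) * n) / 2) = c / 8 * (g (2 ^ (j + 1)) / 2 ^ j)"
        by (simp add: K_def)
      then show "ennreal (c / 8 * (g (2 ^ (j + 1)) / 2 ^ j)) = ennreal (K j) * ennreal (c * 2 ^ ((j + 2) * n) / 2)"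
        using K c by (simp flip: ennreal_mult)
    qed
    also have "\<dots> \<le> (\<Sum>j<N. ennreal (K j) * emeasure lebesgue (D j))"
      by (intro sum_mono mult_left_mono D_vol) simp
    also have "\<dots> = (\<integral>\<^sup>+y. (\<Sum>j<N. ennreal (K j) * indicator (D j) y) \<partial>lebesgue)"
      using D_meas by (subst nn_integral_sum) (auto simp: nn_integral_cmult_indicator)
    also have "\<dots> \<le> tail_integral \<theta>"
      unfolding tail_integral_def
    proof (rule nn_integral_mono)
      fix y :: "real ^ 'n"
      show "(\<Sum>j<N. ennreal (K j) * indicator (D j) y)
          \<le> ennreal (\<theta> y / norm y ^ (CARD('n) + 1)) * indicator {y. 1 \<le> norm y} y"
      proof (cases "\<exists>j<N. y \<in> D j")
        case True
        then obtain j where j: "j < N" "y \<in> D j" by blast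
        have "y \<notin> D i" if "i \<noteq> j" for i using uniq j(2) that by blast
        then have "(\<Sum>i<N. ennreal (K i) * indicator (D i) y) = (\<Sum>i\<in>{j}. ennreal (K i) * indicator (D i) y)"
          using j(1) by (intro sum.mono_neutral_right) auto
        also have "\<dots> \<le> ennreal (\<theta> y / norm y ^ (n + 1))" using j K_le[OF j(2)] by (simp add: ennreal_leI)
        finally have "(\<Sum>i<N. ennreal (K i) * indicator (D i) y) \<le> ennreal (\<theta> y / norm y ^ (n + 1))" .
        moreover have "1 \<le> norm y"
          using j(2) order_trans[OF one_le_power[of "2::real" "j + 1"]] by (simp add: D_iff)
        ultimately show ?thesis by (simp add: n_def)
      next
        case False
        then have "(\<Sum>j<N. ennreal (K j) * indicator (D j) y) = 0" by (auto simp: indicator_def)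
        then show ?thesis by simp
      qed
    qed
    finally show ?thesis .
  qed
  have "summable (\<lambda>j. c / 8 * (g (2 ^ (j + 1)) / 2 ^ j))"
  proof (rule summableI_nonneg_bounded)
    show "0 \<le> c / 8 * (g (2 ^ (j + 1)) / 2 ^ j)" for j using c nn by simp
    show "(\<Sum>j<N. c / 8 * (g (2 ^ (j + 1)) / 2 ^ j)) \<le> enn2real (tail_integral \<theta>)" for N
    proof -
      have "0 \<le> (\<Sum>j<N. c / 8 * (g (2 ^ (j + 1)) / 2 ^ j))" using c nn by (intro sum_nonneg) simp
      then show ?thesis using enn2real_mono[OF partial[of N]] fin by simp
    qed
  qed
  then show ?thesis using c by (subst (asm) summable_cmult_iff) simp
qed

lemma dyadic_interval:
  fixes r :: real
  assumes "1 \<le> r"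
  obtains j :: nat where "2 ^ j \<le> r" "r < 2 ^ (j + 1)"
proof -
  obtain k :: nat where k: "r < 2 ^ k" using real_arch_pow[of 2 r] by auto
  define l where "l = (LEAST k. r < 2 ^ k)"
  have l: "r < 2 ^ l" unfolding l_def using k by (rule LeastI)
  have "l \<noteq> 0" using l assms by (cases l) auto
  then obtain j where j: "l = Suc j" by (cases l) auto
  have "\<not> r < 2 ^ j" using not_less_Least[of j "\<lambda>k. r < 2 ^ k"] j by (simp add: l_def)
  then show thesis using that[of j] l j by simp
qed

text \<open>The function is the bump averaged over the random translation with \<open>m j = \<lceil>g (2 ^ (j + 1))\<rceil>\<close>.  The
convergence of the tail integral makes the random series bounded.  If
\<open>2 ^ j \<le> norm y < 2 ^ (j + 1)\<close>, each of the \<open>m j\<close> factors in group \<open>j\<close> is evaluated at a frequency of norm at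
least \<open>A\<close> and is at most \<open>exp (- 1)\<close>, so their product is at most
\<open>exp (- g (2 ^ (j + 1)))\<close>, and monotonicity turns this into \<open>exp (- \<theta> y)\<close>.\<close>

theorem radial_function_if_tail_converges:
  fixes \<theta> :: "real ^ 'n \<Rightarrow> real"
  assumes nn: "\<And>y. 0 \<le> \<theta> y" and mono: "radially_nondecreasing \<theta>" and fin: "tail_integral \<theta> < \<infinity>"
  shows "\<exists>f :: real ^ 'n \<Rightarrow> complex. f \<in> Cc_infinity \<and> radial f \<and> (\<exists>x. f x \<noteq> 0) \<and>
    (\<exists>C>0. \<forall>y. norm (fourier_transform f y) \<le> C * exp (- \<theta> y))"
proof -
  obtain g where g: "mono_on {0..} g" "\<And>y. \<theta> y = g (norm y)"
    using mono unfolding radially_nondecreasing_def by blast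
  have g_nn: "0 \<le> g r" if "0 \<le> r" for r
    using nn[of "r *\<^sub>R axis undefined 1"] that by (simp add: g(2))
  obtain A where A: "0 < A" and decay: "\<And>y::real^'n. A \<le> norm y \<Longrightarrow> norm (ball_char y) \<le> exp (- 1)"
    using ball_char_decay[of "exp (- 1)", where 'a = "real^'n"] by auto
  define m where "m j = nat \<lceil>g (2 ^ (j + 1))\<rceil>" for j
  have m_ge: "g (2 ^ (j + 1)) \<le> real (m j)" for j by (simp add: m_def real_nat_ceiling_ge)
  have sm: "summable (\<lambda>j. real (m j) / 2 ^ j)"
  proof (rule summable_comparison_test')
    show "summable (\<lambda>j. g (2 ^ (j + 1)) / 2 ^ j + (1 / 2) ^ j)"
      by (intro summable_add summable_of_tail_integral_finite[OF g_nn g fin] summable_geometric) simp_all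
    show "norm (real (m j) / 2 ^ j) \<le> g (2 ^ (j + 1)) / 2 ^ j + (1 / 2) ^ j" for j
    proof -
      have "real (m j) \<le> g (2 ^ (j + 1)) + 1"
        using g_nn[of "2 ^ (j + 1)"] of_int_ceiling_le_add_one[of "g (2 ^ (j + 1))"] by (simp add: m_def)
      then have "real (m j) / 2 ^ j \<le> (g (2 ^ (j + 1)) + 1) / 2 ^ j" by (intro divide_right_mono) auto
      then show ?thesis by (simp add: add_divide_distrib power_one_over)
    qed
  qed
  have A0: "0 \<le> A" using A by simp
  interpret random_translate ball_laws "dyadic_sum A m :: _ \<Rightarrow> real^'n" "\<Sum>j. A * (real (m j) / 2 ^ j)"
    by (rule random_translate_dyadic_sum[OF A0 sm])
  define \<psi> where "\<psi> x = complex_of_real (bump x)" for x :: "real^'n"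
  have \<psi>: "\<psi> \<in> smooth_on_unit_ball"
    using bump_in_smooth_on_unit_ball by (simp add: \<psi>_def[abs_def])
  define f where "f = smear \<psi>"
  have f_smooth: "f \<in> Cc_infinity" unfolding f_def by (rule smear_Cc_infinity[OF \<psi>])
  then have "C_diff 0 f" "compactly_supported f" unfolding Cc_infinity_def by blast+
  then have f_Cc: "f \<in> Cc" by (simp add: Cc_def)
  have ft: "fourier_transform f y = dyadic_char A m y * fourier_transform \<psi> y" for y
    unfolding f_def dyadic_char_def by (rule fourier_transform_smear[OF \<psi>])
  have "radial f"
  proof (rule radial_if_fourier_transform_invariant[OF f_Cc])
    fix Q :: "real^'n \<Rightarrow> real^'n" and y assume Q: "orthogonal_transformation Q"
    have "(\<lambda>x. \<psi> (Q x)) = \<psi>"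
      using Q unfolding \<psi>_def orthogonal_transformation by (intro ext arg_cong[of _ _ complex_of_real] bump_norm_cong) simp
    then have "fourier_transform \<psi> (Q y) = fourier_transform \<psi> y"
      using fourier_transform_orthogonal[OF Q smooth_on_unit_ball_continuous[OF \<psi>], of y] by simp
    then show "fourier_transform f (Q y) = fourier_transform f y"
      by (simp add: ft dyadic_char_orthogonal[OF A0 sm Q])
  qed
  moreover have "\<exists>x. f x \<noteq> 0"
  proof (rule ccontr)
    assume "\<not> ?thesis"
    then have "fourier_transform f 0 = 0" by (simp add: fourier_transform_def)
    then show False
      using fourier_transform_bump_0[where 'a = "real^'n"] by (simp add: ft dyadic_char_0 \<psi>_def[abs_def])
  qed
  moreover have "\<exists>C>0. \<forall>y. norm (fourier_transform f y) \<le> C * exp (- \<theta> y)"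
  proof -
    define K where "K = (\<integral>x. norm (\<psi> x) \<partial>lebesgue) + 1"
    have K: "norm (fourier_transform \<psi> y) \<le> K" for y
      using integral_norm_bound[of lebesgue "\<lambda>x. \<psi> x * exp (- (\<i> * complex_of_real (x \<bullet> y)))"]
      by (simp add: fourier_transform_def K_def norm_mult)
    have K1: "1 \<le> K" by (simp add: K_def)
    \<comment> \<open>the factor \<open>exp (g 1)\<close> pays for frequencies inside the unit ball, where no group helps\<close>
    have g1: "1 \<le> exp (g 1)" using g_nn[of 1] by simp
    have bound: "norm (fourier_transform f y) \<le> K * exp (g 1) * exp (- \<theta> y)" for y
    proof (cases "norm y < 1")
      case True
      then have "\<theta> y \<le> g 1" unfolding g(2) by (intro mono_onD[OF g(1)]) auto
      then have "1 \<le> exp (g 1) * exp (- \<theta> y)" by (simp flip: exp_add)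
      then have "K * 1 \<le> K * (exp (g 1) * exp (- \<theta> y))" using K1 by (intro mult_left_mono) auto
      moreover have "norm (fourier_transform f y) \<le> 1 * K"
        unfolding ft norm_mult by (intro mult_mono norm_dyadic_char_le_1 K) auto
      ultimately show ?thesis by (simp add: mult.assoc)
    next
      case False
      then obtain j :: nat where j: "2 ^ j \<le> norm y" "norm y < 2 ^ (j + 1)"
        using dyadic_interval[of "norm y"] by auto
      have "norm (dyadic_char A m y) \<le> exp (- 1) ^ m j"
      proof (rule dyadic_char_bound[OF A0 sm decay])
        show "A \<le> norm ((A / 2 ^ j) *\<^sub>R y)" using A j by (simp add: field_simps)
      qed
      also have "\<dots> = exp (- real (m j))" by (simp flip: exp_of_nat_mult)
      also have "\<dots> \<le> exp (- \<theta> y)"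
      proof -
        have "\<theta> y \<le> g (2 ^ (j + 1))" unfolding g(2) by (rule mono_onD[OF g(1)]) (use j in auto)
        then show ?thesis using m_ge[of j] by simp
      qed
      finally have "norm (dyadic_char A m y) \<le> exp (- \<theta> y)" .
      then have "norm (fourier_transform f y) \<le> exp (- \<theta> y) * K"
        unfolding ft norm_mult by (intro mult_mono K) auto
      also have "\<dots> * 1 \<le> exp (- \<theta> y) * K * exp (g 1)" using K1 g1 by (intro mult_left_mono) auto
      finally show ?thesis by (simp add: mult_ac)
    qed
    show ?thesis using K1 bound by (intro exI[of _ "K * exp (g 1)"]) auto
  qed
  ultimately show ?thesis using f_smooth by blast
qed

section \<open>The dichotomy\<close>

theorem theorem2p1:
  fixes \<theta> :: "real ^ 'n \<Rightarrow> real"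
  assumes "\<And>y. \<theta> y \<ge> 0"
    and "radial \<theta>"
    and "locally_integrable \<theta>"
  shows "(\<forall>f :: real ^ 'n \<Rightarrow> complex.
            f \<in> Cc \<longrightarrow>
            (\<exists>C>0. \<forall>y. norm (fourier_transform f y) \<le> C * exp (- \<theta> y)) \<longrightarrow>
            tail_integral \<theta> = \<infinity> \<longrightarrow>
            (\<forall>x. f x = 0))
       \<and> (radially_nondecreasing \<theta> \<longrightarrow> tail_integral \<theta> < \<infinity> \<longrightarrow>
            (\<exists>f :: real ^ 'n \<Rightarrow> complex.
               f \<in> Cc_infinity \<and> radial f \<and> (\<exists>x. f x \<noteq> 0) \<and>
               (\<exists>C>0. \<forall>y. norm (fourier_transform f y) \<le> C * exp (- \<theta> y))))"
  using vanishing_if_tail_diverges[of \<theta>, OF assms(1,2)] radial_function_if_tail_converges[of \<theta>, OF assms(1)] by blast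

end
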